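(* For any $m\ge2$, there exist complete $\mathsf U(m)$-invariant Kähler metrics on $\mathbb C^m$ with positive Ricci curvature and positive orthogonal bisectional curvature everywhere, yet whose holomorphic sectional curvature is negative somewhere.
   Context: A Kähler metric on $\mathbb C^m$ is $\mathsf U(m)$-invariant if it is invariant under the standard linear action of the unitary group $\mathsf U(m)$. The curvature tensor has the sign convention that $R(X,Y,Y,X)$ is the sectional curvature for orthonormal real $X,Y$. For $(1,0)$ vectors, orthogonal bisectional curvature is $R(Z,\overline Z,W,\overline W)$ for nonzero $Z,W$ with $\langle Z,\overline W\rangle=0$ ($\langle\cdot,\cdot\rangle$ the complex bilinear extension of the metric); it is positive if this is $>0$ for all such $Z,W$. The holomorphic sectional curvature is $H(Z)=R(Z,\overline Z,Z,\overline Z)$; it is negative somewhere if $H(Z)<0$ for some $(1,0)$ vector $Z$ at some point. *)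

theory Defs
  imports "HOL-Analysis.Analysis" "HOL-Library.Complex_Order"
begin

section \<open>Riemannian metrics on a vector space\<close>

text \<open>
  A metric on a Euclidean space \<open>'a\<close> is a function \<open>g\<close>, where \<open>g p X Y\<close> is the inner product of
  the tangent vectors \<open>X\<close>, \<open>Y\<close> at \<open>p\<close>. Every tangent space is identified with \<open>'a\<close>, so a vector
  \<open>X\<close> is also a constant (coordinate) vector field, and constant fields commute.
\<close>

type_synonym 'a metric_tensor = "'a \<Rightarrow> 'a \<Rightarrow> 'a \<Rightarrow> real"

definition dir_deriv :: "('a::euclidean_space \<Rightarrow> 'b::real_normed_vector) \<Rightarrow> 'a \<Rightarrow> 'a \<Rightarrow> 'b" where
  "dir_deriv f p X = frechet_derivative f (at p) X"

fun Ck :: "nat \<Rightarrow> ('a::euclidean_space \<Rightarrow> real) \<Rightarrow> bool" where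
  "Ck 0 f \<longleftrightarrow> continuous_on UNIV f"
| "Ck (Suc k) f \<longleftrightarrow> (\<forall>p. f differentiable (at p)) \<and> (\<forall>X. Ck k (\<lambda>p. dir_deriv f p X))"

definition smooth :: "('a::euclidean_space \<Rightarrow> real) \<Rightarrow> bool" where
  "smooth f \<longleftrightarrow> (\<forall>k. Ck k f)"

definition riemannian_metric :: "'a::euclidean_space metric_tensor \<Rightarrow> bool" where
  "riemannian_metric g \<longleftrightarrow>
     (\<forall>p. bilinear (g p)) \<and>
     (\<forall>p X Y. g p X Y = g p Y X) \<and>
     (\<forall>p X. X \<noteq> 0 \<longrightarrow> g p X X > 0) \<and>
     (\<forall>X Y. smooth (\<lambda>p. g p X Y))"

text \<open>
  The Levi-Civita derivative \<open>\<nabla>\<^sub>X Y\<close> of constant fields, by the Koszul formula (the bracket terms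
  vanish).
\<close>

definition christoffel :: "'a::euclidean_space metric_tensor \<Rightarrow> 'a \<Rightarrow> 'a \<Rightarrow> 'a \<Rightarrow> 'a" where
  "christoffel g p X Y = (THE V. \<forall>Z. 2 * g p V Z =
     dir_deriv (\<lambda>q. g q Y Z) p X + dir_deriv (\<lambda>q. g q X Z) p Y - dir_deriv (\<lambda>q. g q X Y) p Z)"

definition levi_civita ::
    "'a::euclidean_space metric_tensor \<Rightarrow> 'a \<Rightarrow> ('a \<Rightarrow> 'a) \<Rightarrow> 'a \<Rightarrow> 'a" where
  "levi_civita g X V p = dir_deriv V p X + christoffel g p X (V p)"

text \<open>
  \<open>R(X,Y)Z = \<nabla>\<^sub>X \<nabla>\<^sub>Y Z - \<nabla>\<^sub>Y \<nabla>\<^sub>X Z\<close> for constant fields. With \<open>R(X,Y,Z,W) = \<langle>R(X,Y)Z, W\<rangle>\<close>, the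
  number \<open>R(X,Y,Y,X)\<close> is the sectional curvature of an orthonormal pair \<open>X\<close>, \<open>Y\<close>.
\<close>

definition curv_op :: "'a::euclidean_space metric_tensor \<Rightarrow> 'a \<Rightarrow> 'a \<Rightarrow> 'a \<Rightarrow> 'a \<Rightarrow> 'a" where
  "curv_op g p X Y Z =
     levi_civita g X (levi_civita g Y (\<lambda>_. Z)) p - levi_civita g Y (levi_civita g X (\<lambda>_. Z)) p"

definition curv :: "'a::euclidean_space metric_tensor \<Rightarrow> 'a \<Rightarrow> 'a \<Rightarrow> 'a \<Rightarrow> 'a \<Rightarrow> 'a \<Rightarrow> real" where
  "curv g p X Y Z W = g p (curv_op g p X Y Z) W"

text \<open>
  The Ricci curvature \<open>Ric(Y,Z)\<close> is the trace of \<open>X \<mapsto> R(X,Y)Z\<close>. A trace does not depend on the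
  basis, so it may be computed in the standard basis, which need not be orthonormal for \<open>g\<close>.
\<close>

definition ricci :: "'a::euclidean_space metric_tensor \<Rightarrow> 'a \<Rightarrow> 'a \<Rightarrow> 'a \<Rightarrow> real" where
  "ricci g p Y Z = (\<Sum>b\<in>Basis. curv_op g p b Y Z \<bullet> b)"

definition positive_ricci :: "'a::euclidean_space metric_tensor \<Rightarrow> bool" where
  "positive_ricci g \<longleftrightarrow> (\<forall>p X. X \<noteq> 0 \<longrightarrow> ricci g p X X > 0)"

text \<open>
  Paths are continuous and piecewise \<open>C\<^sup>1\<close> in the sense of \<open>valid_path\<close>, which allows the speed to be
  unbounded, even non-integrable, near a break point. Hence the length is given by
  \<open>has_integral\<close>: with \<open>integral\<close>, a path of infinite length would get length 0.
\<close>

definition has_length ::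
    "'a::euclidean_space metric_tensor \<Rightarrow> (real \<Rightarrow> 'a) \<Rightarrow> real \<Rightarrow> bool" where
  "has_length g \<gamma> L \<longleftrightarrow>
     ((\<lambda>t. sqrt (g (\<gamma> t) (vector_derivative \<gamma> (at t)) (vector_derivative \<gamma> (at t))))
        has_integral L) {0..1}"

definition riem_dist :: "'a::euclidean_space metric_tensor \<Rightarrow> 'a \<Rightarrow> 'a \<Rightarrow> real" where
  "riem_dist g p q =
     Inf {L. \<exists>\<gamma>. valid_path \<gamma> \<and> pathstart \<gamma> = p \<and> pathfinish \<gamma> = q \<and> has_length g \<gamma> L}"

definition complete_metric :: "'a::euclidean_space metric_tensor \<Rightarrow> bool" where
  "complete_metric g \<longleftrightarrow>
     (\<forall>x :: nat \<Rightarrow> 'a.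
        (\<forall>e>0. \<exists>N. \<forall>m\<ge>N. \<forall>n\<ge>N. riem_dist g (x m) (x n) < e) \<longrightarrow>
        (\<exists>l. (\<lambda>n. riem_dist g (x n) l) \<longlonglongrightarrow> 0))"

section \<open>Kaehler metrics on complex coordinate space\<close>

abbreviation J :: "complex^'m \<Rightarrow> complex^'m" where
  "J X \<equiv> \<i> *s X"

definition kaehler_form :: "(complex^'m) metric_tensor \<Rightarrow> (complex^'m) metric_tensor" where
  "kaehler_form g p X Y = g p (J X) Y"

text \<open>The last conjunct says that the Kaehler form is closed: its exterior derivative is evaluated
  on constant fields.\<close>

definition kaehler_metric :: "(complex^'m) metric_tensor \<Rightarrow> bool" where
  "kaehler_metric g \<longleftrightarrow>
     riemannian_metric g \<and>
     (\<forall>p X Y. g p (J X) (J Y) = g p X Y) \<and>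
     (\<forall>p X Y Z. dir_deriv (\<lambda>q. kaehler_form g q Y Z) p X
              + dir_deriv (\<lambda>q. kaehler_form g q Z X) p Y
              + dir_deriv (\<lambda>q. kaehler_form g q X Y) p Z = 0)"

definition unitary_matrix :: "complex^'m^'m \<Rightarrow> bool" where
  "unitary_matrix A \<longleftrightarrow>
     (\<chi> i j. cnj (A $ j $ i)) ** A = mat 1 \<and> A ** (\<chi> i j. cnj (A $ j $ i)) = mat 1"

definition unitary_invariant :: "(complex^'m) metric_tensor \<Rightarrow> bool" where
  "unitary_invariant g \<longleftrightarrow>
     (\<forall>A. unitary_matrix A \<longrightarrow> (\<forall>p X Y. g (A *v p) (A *v X) (A *v Y) = g p X Y))"

section \<open>Complexified tangent vectors\<close>

text \<open>
  The pair \<open>(X, Y)\<close> stands for the vector \<open>X + \<i> Y\<close> of the complexified tangent space. Here \<open>\<i>\<close> is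
  the scalar of the complexification; it is different from \<open>J\<close>, which acts on the two components.
\<close>

type_synonym 'a ctangent = "'a \<times> 'a"

definition conj_vec :: "'a::real_vector ctangent \<Rightarrow> 'a ctangent" where
  "conj_vec Z = (fst Z, - snd Z)"

text \<open>A vector is of type (1,0) iff the complex linear extension of \<open>J\<close> multiplies it by \<open>\<i>\<close>, that is,
  iff \<open>J X + \<i> J Y = \<i> (X + \<i> Y) = - Y + \<i> X\<close>.\<close>

definition type_1_0 :: "(complex^'m) ctangent \<Rightarrow> bool" where
  "type_1_0 Z \<longleftrightarrow> J (fst Z) = - snd Z \<and> J (snd Z) = fst Z"

text \<open>The complex linear extension of a real linear map; applied in each argument separately, it
  gives the complex multilinear extension of a real multilinear map.\<close>

definition cext :: "('a \<Rightarrow> complex) \<Rightarrow> 'a ctangent \<Rightarrow> complex" where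
  "cext f Z = f (fst Z) + \<i> * f (snd Z)"

definition cmetric :: "'a metric_tensor \<Rightarrow> 'a \<Rightarrow> 'a ctangent \<Rightarrow> 'a ctangent \<Rightarrow> complex" where
  "cmetric g p Z W = cext (\<lambda>x. cext (\<lambda>y. of_real (g p x y)) W) Z"

definition ccurv :: "'a::euclidean_space metric_tensor \<Rightarrow> 'a \<Rightarrow>
    'a ctangent \<Rightarrow> 'a ctangent \<Rightarrow> 'a ctangent \<Rightarrow> 'a ctangent \<Rightarrow> complex" where
  "ccurv g p Z1 Z2 Z3 Z4 =
     cext (\<lambda>x1. cext (\<lambda>x2. cext (\<lambda>x3. cext (\<lambda>x4. of_real (curv g p x1 x2 x3 x4)) Z4) Z3) Z2) Z1"

text \<open>In the following inequalities, \<open><\<close> is the order of complex numbers, so they also say that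
  the values are real.\<close>

definition bisect_curv ::
    "'a::euclidean_space metric_tensor \<Rightarrow> 'a \<Rightarrow> 'a ctangent \<Rightarrow> 'a ctangent \<Rightarrow> complex" where
  "bisect_curv g p Z W = ccurv g p Z (conj_vec Z) W (conj_vec W)"

definition hol_sect_curv ::
    "'a::euclidean_space metric_tensor \<Rightarrow> 'a \<Rightarrow> 'a ctangent \<Rightarrow> complex" where
  "hol_sect_curv g p Z = ccurv g p Z (conj_vec Z) Z (conj_vec Z)"

definition positive_orthogonal_bisect_curv :: "(complex^'m) metric_tensor \<Rightarrow> bool" where
  "positive_orthogonal_bisect_curv g \<longleftrightarrow>
     (\<forall>p Z W. type_1_0 Z \<and> type_1_0 W \<and> Z \<noteq> 0 \<and> W \<noteq> 0 \<and> cmetric g p Z (conj_vec W) = 0 \<longrightarrow>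
        bisect_curv g p Z W > 0)"

definition hol_sect_curv_negative_somewhere :: "(complex^'m) metric_tensor \<Rightarrow> bool" where
  "hol_sect_curv_negative_somewhere g \<longleftrightarrow> (\<exists>p Z. type_1_0 Z \<and> hol_sect_curv g p Z < 0)"

end

theory Submission
  imports Defs
begin

text \<open>
  The metric has the Kaehler potential \<open>2 sqrt (1 + |z|\<^sup>2)\<close>: with \<open>s = |p|\<^sup>2\<close> and
  \<open>f(s) = (1 + s) powr (-1/2)\<close> it is the real part of \<open>f \<langle>X,Y\<rangle> + f' \<langle>X,p\<rangle> \<langle>p,Y\<rangle>\<close>. Its
  Christoffel symbols are rational in \<open>s\<close>, so all curvatures can be computed. In the radial
  complex direction the holomorphic sectional curvature has the sign of \<open>8 + 4 s - s\<^sup>2\<close>, so it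
  is negative for large \<open>s\<close>, but the other directions compensate for it in the Ricci and in the
  orthogonal bisectional curvature. The metric is complete because the homeomorphism
  \<open>p \<mapsto> (1 + s) powr (-1/4) p / sqrt 2\<close> onto the Euclidean space does not increase lengths.
\<close>

subsection \<open>The Hermitian product\<close>

text \<open>On the complex line through 0 and p the metric is h(s) |dz|^2 with h = f + s f' = (2 +
  s) / (2 (1 + s) powr (3/2)). Two features of the potential show up there. Growth like 2 |z| makes
  h decay only like 1 / (2 |z|), so rays have infinite length. The curvature of the line has the
  sign of -(s h'/h)': the function s h'/h starts at 0, falls below -1/2 and then rises back to its
  limit -1/2, so the curvature is positive near the origin and negative far out. The compensation
  comes from the transverse directions: two orthogonal vectors cannot both be radial, and for m at
  least 2 the Ricci curvature of a radial vector also contains bisectional curvatures with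
  transverse vectors. The definitions are real while the geometry is complex, so every tensor is
  written through \<open>herm\<close> and split into parts that are complex linear or antilinear in
  each argument.\<close>

definition herm :: "complex^'m \<Rightarrow> complex^'m \<Rightarrow> complex" where
  "herm X Y = (\<Sum>i\<in>UNIV. X $ i * cnj (Y $ i))"

lemma herm_add_left: "herm (X + Y) Z = herm X Z + herm Y Z"
  and herm_add_right: "herm Z (X + Y) = herm Z X + herm Z Y"
  by (simp_all add: herm_def algebra_simps sum.distrib)

lemma herm_vscale_left: "herm (c *s X) Y = c * herm X Y"
  and herm_vscale_right: "herm X (c *s Y) = cnj c * herm X Y"
  by (simp_all add: herm_def sum_distrib_left algebra_simps)

lemma scaleR_eq_vscale: "r *\<^sub>R (X :: complex^'m) = of_real r *s X"
  by (simp add: vec_eq_iff scaleR_conv_of_real[symmetric])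

lemma herm_scaleR_left: "herm (r *\<^sub>R X) Y = of_real r * herm X Y"
  and herm_scaleR_right: "herm X (r *\<^sub>R Y) = of_real r * herm X Y"
  by (simp_all add: scaleR_eq_vscale herm_vscale_left herm_vscale_right)

lemma herm_minus_left: "herm (- X) Y = - herm X Y"
  and herm_minus_right: "herm X (- Y) = - herm X Y"
  by (simp_all add: herm_def sum_negf)

lemma herm_diff_left: "herm (X - Y) Z = herm X Z - herm Y Z"
  and herm_diff_right: "herm Z (X - Y) = herm Z X - herm Z Y"
  by (simp_all add: herm_def algebra_simps sum_subtractf)

lemmas herm_linear = herm_add_left herm_add_right herm_vscale_left herm_vscale_right
  herm_scaleR_left herm_scaleR_right herm_minus_left herm_minus_right herm_diff_left herm_diff_right

lemma cnj_herm: "cnj (herm X Y) = herm Y X"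
  by (simp add: herm_def mult.commute)

lemma Re_herm: "Re (herm X Y) = X \<bullet> Y"
  by (simp add: herm_def inner_vec_def inner_complex_def)

lemma herm_same: "herm X X = of_real (X \<bullet> X)"
proof -
  have "Im (herm X X) = 0"
    using arg_cong[OF cnj_herm[of X X], of Im] by simp
  then show ?thesis by (simp add: complex_eq_iff Re_herm)
qed

lemma bounded_bilinear_herm: "bounded_bilinear (herm :: complex^'m \<Rightarrow> _)"
  unfolding bilinear_conv_bounded_bilinear[symmetric]
  by (auto simp: bilinear_def linear_iff herm_linear scaleR_conv_of_real[where 'a=complex])

lemma bounded_bilinear_vscale: "bounded_bilinear ((*s) :: complex \<Rightarrow> complex^'m \<Rightarrow> _)"
  unfolding bilinear_conv_bounded_bilinear[symmetric]
  by (auto simp: bilinear_def linear_iff vec_eq_iff algebra_simps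
        scaleR_conv_of_real[where 'a=complex])

lemmas has_derivative_herm [derivative_intros] = bounded_bilinear.FDERIV[OF bounded_bilinear_herm]
lemmas has_derivative_vscale [derivative_intros] = bounded_bilinear.FDERIV[OF
      bounded_bilinear_vscale]

lemma herm_Cauchy_Schwarz: "(cmod (herm X Y))\<^sup>2 \<le> (X \<bullet> X) * (Y \<bullet> Y)"
proof (cases "herm X Y = 0")
  case False
  \<comment> \<open>Multiplying X by this unit phase makes the product with Y real and nonnegative,
    hence equal to the real inner product, to which the real Cauchy-Schwarz inequality
    applies.\<close>
  define u where "u = cnj (sgn (herm X Y))"
  have [simp]: "cmod u = 1" using False by (simp add: u_def norm_sgn)
  have "herm (u *s X) Y = herm X Y * cnj (herm X Y) / of_real (cmod (herm X Y))"
    by (simp add: u_def herm_linear sgn_eq)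
  also have "\<dots> = of_real (cmod (herm X Y))"
    using False by (simp add: power2_eq_square flip: complex_norm_square)
  finally have "herm (u *s X) Y = of_real (cmod (herm X Y))" .
  then have "cmod (herm X Y) = (u *s X) \<bullet> Y" by (simp flip: Re_herm)
  then have "(cmod (herm X Y))\<^sup>2 \<le> ((u *s X) \<bullet> (u *s X)) * (Y \<bullet> Y)"
    by (metis Cauchy_Schwarz_ineq)
  also have "herm (u *s X) (u *s X) = herm X X"
    using complex_norm_square[of u]
      by (simp add: herm_linear mult.assoc[symmetric] mult.commute[of "cnj u"])
  then have "(u *s X) \<bullet> (u *s X) = X \<bullet> X" by (simp flip: Re_herm)
  finally show ?thesis .
qed simp

lemma herm_matrix_unitary:
  assumes "unitary_matrix A"
  shows "herm (A *v X) (A *v Y) = herm X Y"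
proof -
  let ?B = "(\<chi> i j. cnj (A $ j $ i)) :: complex^'a^'a"
  have *: "herm (A *v X) Z = herm X (?B *v Z)" for Z
    unfolding herm_def matrix_vector_mult_def
    by (simp add: sum_distrib_left sum_distrib_right, subst sum.swap, simp add: mult_ac)
  show ?thesis
    using assms by (simp add: * unitary_matrix_def matrix_vector_mul_assoc)
qed

lemma dir_derivI: "(f has_derivative D) (at p) \<Longrightarrow> dir_deriv f p X = D X"
  by (metis dir_deriv_def frechet_derivative_at)

subsection \<open>Smooth functions\<close>

text \<open>The product rule mixes derivatives with undifferentiated factors; the induction in
  \<open>Ck_mult\<close> has to lower the order of the latter.\<close>

lemma Ck_SucD: "Ck (Suc k) f \<Longrightarrow> Ck k f"
proof (induction k arbitrary: f)
  case 0
  then show ?case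
    by (auto intro!: continuous_at_imp_continuous_on differentiable_imp_continuous_within)
next
  case (Suc k)
  then show ?case unfolding Ck.simps(2)[of "Suc k"] Ck.simps(2)[of k] by blast
qed

lemma Ck_SucI:
  assumes "\<And>p. (f has_derivative D p) (at p)" "\<And>X. Ck k (\<lambda>p. D p X)"
  shows "Ck (Suc k) f"
proof -
  have "dir_deriv f p X = D p X" for p X by (rule dir_derivI[OF assms(1)])
  then show ?thesis using assms by (auto simp: differentiable_def)
qed

lemma Ck_SucE:
  assumes "Ck (Suc k) f"
  obtains D where "\<And>p. (f has_derivative D p) (at p)" "\<And>X. Ck k (\<lambda>p. D p X)"
  using assms that[of "\<lambda>p. frechet_derivative f (at p)"]
  by (simp add: dir_deriv_def flip: frechet_derivative_works)

lemma Ck_const: "Ck k (\<lambda>_. c)"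
proof (induction k arbitrary: c)
  case (Suc k) then show ?case by (intro Ck_SucI[where D = "\<lambda>_ _. 0"]) auto
qed simp

lemma Ck_add: "Ck k f \<Longrightarrow> Ck k g \<Longrightarrow> Ck k (\<lambda>p. f p + g p)"
proof (induction k arbitrary: f g)
  case 0 then show ?case by (simp add: continuous_on_add)
next
  case (Suc k)
  obtain D where D: "\<And>p. (f has_derivative D p) (at p)" "\<And>X. Ck k (\<lambda>p. D p X)"
    using Ck_SucE[OF Suc.prems(1)] by blast
  obtain E where E: "\<And>p. (g has_derivative E p) (at p)" "\<And>X. Ck k (\<lambda>p. E p X)"
    using Ck_SucE[OF Suc.prems(2)] by blast
  show ?case
    by (rule Ck_SucI, rule has_derivative_add[OF D(1) E(1)], rule Suc.IH[OF D(2) E(2)])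
qed

lemma Ck_mult: "Ck k f \<Longrightarrow> Ck k g \<Longrightarrow> Ck k (\<lambda>p. f p * g p)"
proof (induction k arbitrary: f g)
  case 0 then show ?case by (simp add: continuous_on_mult)
next
  case (Suc k)
  obtain D where D: "\<And>p. (f has_derivative D p) (at p)" "\<And>X. Ck k (\<lambda>p. D p X)"
    using Ck_SucE[OF Suc.prems(1)] by blast
  obtain E where E: "\<And>p. (g has_derivative E p) (at p)" "\<And>X. Ck k (\<lambda>p. E p X)"
    using Ck_SucE[OF Suc.prems(2)] by blast
  show ?case
    by (rule Ck_SucI, rule has_derivative_mult[OF D(1) E(1)],
        intro Ck_add Suc.IH D(2) E(2) Suc.prems[THEN Ck_SucD])
qed

lemma Ck_bounded_linear: "bounded_linear f \<Longrightarrow> Ck k f"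
  by (cases k) (auto simp: linear_continuous_on simp del: Ck.simps(2)
      intro!: Ck_SucI[where D = "\<lambda>_. f"] bounded_linear_imp_has_derivative Ck_const)

subsection \<open>The metric and its Levi-Civita connection\<close>

definition weight :: "complex^'m \<Rightarrow> real" where
  "weight p = 1 / sqrt (1 + p \<bullet> p)"

definition root_metric :: "(complex^'m) metric_tensor" where
  "root_metric p X Y = weight p * (X \<bullet> Y) - weight p ^ 3 / 2 * Re (herm X p * herm p Y)"

lemma one_plus_inner_pos: "1 + p \<bullet> p > (0 :: real)"
  by (simp add: add_pos_nonneg)

lemma weight_pos: "weight p > 0"
  by (simp add: weight_def one_plus_inner_pos)

lemma weight_square: "(weight p)\<^sup>2 = 1 / (1 + p \<bullet> p)"
  using one_plus_inner_pos[of p] by (simp add: weight_def power_divide)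

lemma has_derivative_weight: "(weight has_derivative (\<lambda>X. - (p \<bullet> X) * weight p ^ 3)) (at p)"
proof -
  have *: "sqrt (1 + p \<bullet> p) \<noteq> 0" "1 + p \<bullet> p > 0"
    using one_plus_inner_pos[of p] by auto
  show ?thesis
    unfolding weight_def
    by (rule derivative_eq_intros refl *)+
      (use * in \<open>auto simp: fun_eq_iff inner_commute divide_simps power3_eq_cube power2_eq_square\<close>)
qed

lemma herm_Re_commute: "Re (herm X Y) = Re (herm Y X)"
  and herm_Im_commute: "Im (herm X Y) = - Im (herm Y X)"
  by (simp_all flip: cnj_herm[of X Y])

definition root_deriv :: "complex^'m \<Rightarrow> complex^'m \<Rightarrow> complex^'m \<Rightarrow> complex^'m \<Rightarrow> real" where
  "root_deriv p X Y Z = - (weight p ^ 3) * (p \<bullet> X) * (Y \<bullet> Z)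
     + 3 / 2 * weight p ^ 5 * (p \<bullet> X) * Re (herm Y p * herm p Z)
     - weight p ^ 3 / 2 * Re (herm Y X * herm p Z + herm Y p * herm X Z)"

lemma has_derivative_root_metric:
    "((\<lambda>p. root_metric p Y Z) has_derivative (\<lambda>X. root_deriv p X Y Z)) (at p)"
proof -
  have "((\<lambda>p. weight p ^ 3) has_derivative (\<lambda>X. - 3 * weight p ^ 5 * (p \<bullet> X))) (at p)"
    by (rule has_derivative_eq_rhs[OF has_derivative_power[OF has_derivative_weight]])
      (simp add: fun_eq_iff eval_nat_numeral)
  note W3 = this
  have "((\<lambda>p. herm Y p * herm p Z) has_derivative (\<lambda>X. herm Y X * herm p Z
      + herm Y p * herm X Z)) (at p)"
    by (rule derivative_eq_intros refl)+ (simp add: fun_eq_iff herm_def)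
  note R = bounded_linear.has_derivative[OF bounded_linear_Re this]
  show ?thesis
    unfolding root_metric_def
    by (rule has_derivative_eq_rhs, rule has_derivative_diff[OF
          has_derivative_mult_left[OF has_derivative_weight]
          has_derivative_mult[OF bounded_linear.has_derivative[OF bounded_linear_divide W3] R]])
      (simp add: fun_eq_iff root_deriv_def field_simps)
qed

lemma dir_deriv_root_metric: "dir_deriv (\<lambda>p. root_metric p Y Z) p X = root_deriv p X Y Z"
  by (rule dir_derivI[OF has_derivative_root_metric])

text \<open>Complex linearly, the Levi-Civita derivative is \<open>\<nabla>\<^sub>X Y = a (\<langle>X,p\<rangle> Y + \<langle>Y,p\<rangle> X) + b \<langle>X,p\<rangle>
  \<langle>Y,p\<rangle> p\<close> with \<open>a = f'/f\<close> and \<open>b = (f'' - 2 f'\<^sup>2/f) / (f + s f')\<close>.\<close>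

definition chr_a :: "complex^'m \<Rightarrow> real" where "chr_a p = - 1 / (2 * (1 + p \<bullet> p))"
definition chr_b :: "complex^'m \<Rightarrow> real" where "chr_b p = 1 / (2 * (1 + p \<bullet> p) * (2 + p \<bullet> p))"

definition chr_vec :: "complex^'m \<Rightarrow> complex^'m \<Rightarrow> complex^'m \<Rightarrow> complex^'m" where
  "chr_vec p X Y = (of_real (chr_a p) * herm X p) *s Y + (of_real (chr_a p) * herm Y p) *s X
     + (of_real (chr_b p) * herm X p * herm Y p) *s p"

text \<open>Dividing the formula for b by f gives b (1 + a s) = f''/f - 2 a^2, and f f'' = 3 f'^2
  for this f. The relation drives the cancellations in the connection and in the curvature.\<close>

lemma chr_b_chr_a: "chr_b p * (1 + chr_a p * (p \<bullet> p)) = (chr_a p)\<^sup>2"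
proof -
  have "1 + p \<bullet> p > 0" "2 + p \<bullet> p > 0" by (simp_all add: add_pos_nonneg)
  then show ?thesis by (simp add: chr_b_def chr_a_def divide_simps power2_eq_square)
qed

lemma chr_a_weight: "chr_a p = - (weight p)\<^sup>2 / 2"
  by (simp add: chr_a_def weight_square)

text \<open>The coefficients are f' and f'': the right side is the real part of the holomorphic
  X-derivative of f <Y,Z> + f' <Y,p> <p,Z>, which determines the connection of a Kaehler
  metric.\<close>

lemma root_metric_chr_vec:
  "root_metric p (chr_vec p X Y) Z
      = Re (- (of_real (weight p ^ 3) / 2) * (herm X p * herm Y Z + herm Y p * herm X Z)
     + 3 / 4 * of_real (weight p ^ 5) * (herm X p * herm Y p * herm p Z))"
proof -
  let ?a = "herm X p" and ?b = "herm Y p"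
  have 1: "weight p * chr_a p = - (weight p ^ 3) / 2"
    by (simp add: chr_a_weight eval_nat_numeral)
  have 2: "weight p * chr_b p - weight p ^ 3 / 2 * (2 * chr_a p + chr_b p * (p \<bullet> p))
      = 3 / 4 * weight p ^ 5"
  proof -
    have "weight p * chr_b p - weight p ^ 3 / 2 * (2 * chr_a p + chr_b p * (p \<bullet> p))
      = weight p * (chr_b p * (1 + chr_a p * (p \<bullet> p))) + weight p ^ 5 / 2"
      by (simp add: chr_a_weight field_simps eval_nat_numeral)
    also have "\<dots> = 3 / 4 * weight p ^ 5"
      unfolding chr_b_chr_a by (simp add: chr_a_weight algebra_simps eval_nat_numeral)
    finally show ?thesis .
  qed
  have "root_metric p (chr_vec p X Y) Z = Re (of_real (weight p) * herm (chr_vec p X Y) Z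
      - of_real (weight p ^ 3 / 2) * (herm (chr_vec p X Y) p * herm p Z))"
    by (simp add: root_metric_def Re_herm)
  also have
      "of_real (weight p) * herm (chr_vec p X Y) Z
          - of_real (weight p ^ 3 / 2) * (herm (chr_vec p X Y) p * herm p Z)
     = of_real (weight p * chr_a p) * (?a * herm Y Z + ?b * herm X Z)
     + of_real (weight p * chr_b p - weight p ^ 3 / 2 * (2 * chr_a p + chr_b p * (p \<bullet> p))) *
         (?a * ?b * herm p Z)"
    by (simp add: chr_vec_def herm_linear herm_same algebra_simps)
  finally show ?thesis unfolding 1 2 by simp
qed

lemma koszul_chr_vec:
    "2 * root_metric p (chr_vec p X Y) Z
        = root_deriv p X Y Z + root_deriv p Y X Z - root_deriv p Z X Y"
proof -
  \<comment> \<open>Keeping one member of each conjugate pair turns the Koszul identity into a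
    polynomial identity in real and imaginary parts.\<close>
  have *: "herm p V = cnj (herm V p)" "p \<bullet> V = Re (herm V p)" for V
    by (simp_all add: cnj_herm Re_herm inner_commute)
  have **: "herm Y X = cnj (herm X Y)" "herm Z X = cnj (herm X Z)" "herm Z Y = cnj (herm Y Z)"
    by (simp_all add: cnj_herm)
  show ?thesis
    unfolding root_metric_chr_vec root_deriv_def Re_herm[symmetric] * **
    by (simp add: field_simps)
qed

section \<open>Positivity, smoothness, closedness and invariance of the metric\<close>

lemma root_metric_add: "root_metric p (X + Y) Z = root_metric p X Z + root_metric p Y Z"
  and root_metric_add_right: "root_metric p Z (X + Y) = root_metric p Z X + root_metric p Z Y"
  and root_metric_scaleR: "root_metric p (c *\<^sub>R X) Z = c * root_metric p X Z"
  and root_metric_scaleR_right: "root_metric p X (c *\<^sub>R Z) = c * root_metric p X Z"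
  and root_metric_diff: "root_metric p (X - Y) Z = root_metric p X Z - root_metric p Y Z"
  by (simp_all add: root_metric_def herm_linear algebra_simps)

lemma root_metric_commute: "root_metric p X Y = root_metric p Y X"
  by (simp add: root_metric_def inner_commute herm_Re_commute[of p] herm_Im_commute[of p]
        algebra_simps)

text \<open>By Cauchy-Schwarz the correction term removes at most the fraction s / (2 (1 + s)) of
  the first term. The lower bound later controls \<open>short_map\<close>, the upper one the length
  of segments.\<close>

lemma root_metric_lower: "root_metric p X X \<ge> weight p * (X \<bullet> X) / 2"
  and root_metric_upper: "root_metric p X X \<le> X \<bullet> X"
proof -
  have "Re (herm X p * herm p X) = (cmod (herm X p))\<^sup>2"
    by (metis cnj_herm complex_norm_square Re_complex_of_real)
  then have eq: "root_metric p X X = weight p * (X \<bullet> X) - weight p ^ 3 / 2 * (cmod (herm X p))\<^sup>2"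
    by (simp add: root_metric_def)
  have "weight p ^ 3 / 2 * (cmod (herm X p))\<^sup>2 \<le> weight p ^ 3 / 2 * ((X \<bullet> X) * (p \<bullet> p))"
    using herm_Cauchy_Schwarz[of X p] weight_pos[of p] by (intro mult_left_mono) auto
  also have "\<dots> = weight p * ((weight p)\<^sup>2 * (p \<bullet> p)) / 2 * (X \<bullet> X)"
    by (simp add: algebra_simps eval_nat_numeral)
  also have "\<dots> \<le> weight p * 1 / 2 * (X \<bullet> X)"
    using weight_pos[of p] by (intro mult_right_mono divide_right_mono mult_left_mono)
      (auto simp: weight_square divide_simps add_pos_nonneg)
  finally show "root_metric p X X \<ge> weight p * (X \<bullet> X) / 2" unfolding eq by simp
  have "weight p \<le> 1" by (simp add: weight_def divide_simps)
  moreover have "weight p ^ 3 / 2 * (cmod (herm X p))\<^sup>2 \<ge> 0" using weight_pos[of p] by simp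
  ultimately show "root_metric p X X \<le> X \<bullet> X"
    unfolding eq using mult_right_mono[of "weight p" 1 "X \<bullet> X"] by simp
qed

lemma root_metric_pos: "X \<noteq> 0 \<Longrightarrow> root_metric p X X > 0"
  using root_metric_lower[of p X] weight_pos[of p]
    by (smt (verit) divide_pos_pos inner_gt_zero_iff mult_pos_pos)

lemma christoffel_root_metric: "christoffel root_metric p X Y = chr_vec p X Y"
  unfolding christoffel_def dir_deriv_root_metric
proof (rule the_equality, safe)
  show "2 * root_metric p (chr_vec p X Y) Z
      = root_deriv p X Y Z + root_deriv p Y X Z - root_deriv p Z X Y" for Z
    by (rule koszul_chr_vec)
  fix V assume V:
      "\<forall>Z. 2 * root_metric p V Z = root_deriv p X Y Z + root_deriv p Y X Z - root_deriv p Z X Y"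
  have "root_metric p (V - chr_vec p X Y) (V - chr_vec p X Y) = 0"
    using koszul_chr_vec[of p X Y "V - chr_vec p X Y"] V[rule_format, of "V - chr_vec p X Y"]
    unfolding root_metric_diff by linarith
  then show "V = chr_vec p X Y" by (metis root_metric_pos less_irrefl eq_iff_diff_eq_0)
qed

text \<open>The derivative of \<open>weight\<close> is a polynomial in \<open>weight\<close> and a
  linear form, so the induction hypothesis and closure under products give the next order.\<close>

lemma Ck_weight: "Ck k (weight :: complex^'m \<Rightarrow> real)"
proof (induction k)
  case 0
  have "1 + p \<bullet> p \<noteq> 0" for p :: "complex^'m" using one_plus_inner_pos[of p] by simp
  then show ?case unfolding Ck.simps weight_def by (intro continuous_intros) auto
next
  case (Suc k)
  have "Ck k (\<lambda>p. (- 1) * (p \<bullet> X) * (weight p * (weight p * weight p)))" for X :: "complex^'m"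
    by (intro Ck_mult Ck_const Suc.IH) (intro Ck_bounded_linear bounded_linear_inner_left)
  then show ?case
    by (intro Ck_SucI[OF has_derivative_weight]) (simp add: power3_eq_cube mult.assoc)
qed

lemma bounded_linear_Re_herm: "bounded_linear (\<lambda>p. Re (herm X p))"
    "bounded_linear (\<lambda>p. Im (herm X p))"
  using bounded_bilinear.bounded_linear_right[OF bounded_bilinear_herm]
  by (auto intro: bounded_linear_compose[OF bounded_linear_Re]
        bounded_linear_compose[OF bounded_linear_Im])

lemma riemannian_root_metric: "riemannian_metric (root_metric :: (complex^'m) metric_tensor)"
proof -
  have "bilinear (root_metric p)" for p :: "complex^'m"
    by (auto simp: bilinear_def linear_iff root_metric_add root_metric_add_right
          root_metric_scaleR root_metric_scaleR_right)
  moreover have "Ck k (\<lambda>p. root_metric p X Y)" for k and X Y :: "complex^'m"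
  proof -
    have eq: "root_metric p X Y
        = weight p * (X \<bullet> Y) + (- 1 / 2) * (weight p * (weight p * weight p)) *
        (Re (herm X p) * Re (herm Y p) + Im (herm X p) * Im (herm Y p))" for p
      by (simp add: root_metric_def herm_Re_commute[of p] herm_Im_commute[of p] power3_eq_cube)
    show ?thesis unfolding eq
      by (intro Ck_add Ck_mult Ck_const Ck_weight Ck_bounded_linear bounded_linear_Re_herm)
  qed
  ultimately show ?thesis
    unfolding riemannian_metric_def smooth_def using root_metric_commute root_metric_pos by blast
qed

lemma kaehler_root_metric: "kaehler_metric (root_metric :: (complex^'m) metric_tensor)"
proof -
  have "root_metric p (J X) (J Y) = root_metric p X Y" for p X Y :: "complex^'m"
    by (simp add: root_metric_def herm_linear flip: Re_herm)
  moreover have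
      "root_deriv p X (J Y) Z + root_deriv p Y (J Z) X + root_deriv p Z (J X) Y
          = 0" for p X Y Z :: "complex^'m"
  proof -
    have *: "herm p V = cnj (herm V p)" "p \<bullet> V = Re (herm V p)" for V
      by (simp_all add: cnj_herm Re_herm inner_commute)
    have **: "herm Y X = cnj (herm X Y)" "herm Z X = cnj (herm X Z)" "herm Z Y = cnj (herm Y Z)"
      by (simp_all add: cnj_herm)
    show ?thesis
      unfolding root_deriv_def Re_herm[symmetric] herm_vscale_left * ** by (simp add: field_simps)
  qed
  ultimately show ?thesis
    by (simp add: kaehler_metric_def riemannian_root_metric kaehler_form_def dir_deriv_root_metric)
qed

lemma unitary_invariant_root_metric: "unitary_invariant root_metric"
  by (simp add: unitary_invariant_def root_metric_def weight_def herm_matrix_unitary flip: Re_herm)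

subsection \<open>Curvature\<close>

text \<open>The derivative of b with respect to s. Its companion a' equals 2 a^2 and gets no
  symbol.\<close>

definition chr_b_deriv :: "complex^'m \<Rightarrow> real" where
  "chr_b_deriv p = - (3 + 2 * (p \<bullet> p)) / (2 * (1 + p \<bullet> p)\<^sup>2 * (2 + p \<bullet> p)\<^sup>2)"

lemma has_derivative_chr_a: "(chr_a has_derivative (\<lambda>V. 4 * (chr_a p)\<^sup>2 * (p \<bullet> V))) (at p)"
  unfolding chr_a_weight[abs_def]
  by (rule has_derivative_eq_rhs, rule bounded_linear.has_derivative[OF bounded_linear_divide
      has_derivative_minus[OF has_derivative_power[OF has_derivative_weight]]])
    (simp add: fun_eq_iff eval_nat_numeral)

lemma has_derivative_chr_b: "(chr_b has_derivative (\<lambda>V. 2 * chr_b_deriv p * (p \<bullet> V))) (at p)"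
proof -
  have *: "1 + p \<bullet> p > 0" "2 + p \<bullet> p > 0" by (simp_all add: add_pos_nonneg)
  have "((\<lambda>s. 1 / (2 * (1 + s) * (2 + s))) has_real_derivative chr_b_deriv p) (at (p \<bullet> p))"
    unfolding chr_b_deriv_def
    using * by (auto intro!: derivative_eq_intros simp: divide_simps power2_eq_square)
       (auto simp: algebra_simps)
  then have 1: "((\<lambda>s. 1 / (2 * (1 + s) * (2 + s))) has_derivative (*) (chr_b_deriv p)) (at (p \<bullet> p))"
    by (simp add: has_field_derivative_def)
  have 2: "((\<lambda>p. p \<bullet> p) has_derivative (\<lambda>V. p \<bullet> V + V \<bullet> p)) (at p)"
    by (rule derivative_intros)+
  show ?thesis
    by (rule has_derivative_eq_rhs, unfold chr_b_def[abs_def], rule has_derivative_compose[OF 2 1])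
      (simp add: fun_eq_iff inner_commute)
qed

text \<open>The part of \<open>D\<^sub>X \<nabla>\<^sub>Y Z\<close> that is antilinear in \<open>X\<close>. The linear part is cancelled by the
  quadratic terms of the curvature after antisymmetrization, since the metric is Kaehler.\<close>

definition curv_part :: "complex^'m \<Rightarrow> complex^'m \<Rightarrow> complex^'m \<Rightarrow> complex^'m \<Rightarrow> complex^'m" where
  "curv_part p X Y Z =
     (2 * of_real ((chr_a p)\<^sup>2) * herm p X * herm Y p + of_real (chr_a p) * herm Y X) *s Z
   + (2 * of_real ((chr_a p)\<^sup>2) * herm p X * herm Z p + of_real (chr_a p) * herm Z X) *s Y
   + (of_real (chr_b_deriv p) * herm p X * herm Y p * herm Z p
      + of_real (chr_b p) * (herm Y X * herm Z p + herm Y p * herm Z X)) *s p"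

lemma has_derivative_chr_vec:
  "((\<lambda>p. chr_vec p Y Z) has_derivative (\<lambda>X. curv_part p X Y Z
     + (2 * of_real ((chr_a p)\<^sup>2) * herm X p) *s (herm Y p *s Z + herm Z p *s Y)
     + (of_real (chr_b_deriv p) * herm X p * herm Y p * herm Z p) *s p
     + (of_real (chr_b p) * herm Y p * herm Z p) *s X)) (at p)"
proof -
  have h: "((\<lambda>p. herm Y p) has_derivative (\<lambda>X. herm Y X)) (at p)" for Y
    by (intro bounded_linear_imp_has_derivative
        bounded_bilinear.bounded_linear_right[OF bounded_bilinear_herm])
  note a = bounded_linear.has_derivative[OF bounded_linear_of_real has_derivative_chr_a[of p]]
  note b = bounded_linear.has_derivative[OF bounded_linear_of_real has_derivative_chr_b[of p]]
  note m = has_derivative_mult and v = has_derivative_vscale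
  \<comment> \<open>This splits the derivative of a function of s into a part linear in X and a part
    antilinear in X; the latter goes into \<open>curv_part\<close>.\<close>
  have re: "of_real (p \<bullet> X) = (herm X p + herm p X) / 2" for X
    using complex_add_cnj[of "herm X p"] by (simp add: cnj_herm Re_herm inner_commute)
  show ?thesis
    unfolding chr_vec_def
    by (rule has_derivative_eq_rhs, rule has_derivative_add[OF has_derivative_add[OF
         v[OF m[OF a h] has_derivative_const] v[OF m[OF a h] has_derivative_const]]
         v[OF m[OF m[OF b h] h] has_derivative_ident]])
      (simp add: fun_eq_iff vec_eq_iff curv_part_def re field_simps)
qed

lemma curv_op_root_metric: "curv_op root_metric p X Y Z = curv_part p X Y Z - curv_part p Y X Z"
proof -
  have 1: "levi_civita root_metric Y (\<lambda>_. Z) = (\<lambda>q. chr_vec q Y Z)" for Y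
    by (simp add: fun_eq_iff levi_civita_def christoffel_root_metric
          dir_derivI[OF has_derivative_const])
  have 2: "levi_civita root_metric X (\<lambda>q. chr_vec q Y Z) p = curv_part p X Y Z
     + (2 * of_real ((chr_a p)\<^sup>2) * herm X p) *s (herm Y p *s Z + herm Z p *s Y)
     + (of_real (chr_b_deriv p) * herm X p * herm Y p * herm Z p) *s p
     + (of_real (chr_b p) * herm Y p * herm Z p) *s X + chr_vec p X (chr_vec p Y Z)" for X Y
    by (simp add: levi_civita_def christoffel_root_metric dir_derivI[OF has_derivative_chr_vec])
  have 3: "chr_vec p X (chr_vec p Y Z) =
       (of_real (chr_a p) * herm X p) *s chr_vec p Y Z
     + (of_real (chr_a p * (2 * chr_a p + chr_b p * (p \<bullet> p))) * herm Y p * herm Z p) *s X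
     + (of_real (chr_b p * (2 * chr_a p + chr_b p * (p \<bullet> p))) * herm X p * herm Y p * herm Z
           p) *s p" for X Y
  proof -
    have "herm (chr_vec p Y Z) p = of_real (2 * chr_a p + chr_b p * (p \<bullet> p)) * herm Y p * herm Z p"
      by (simp add: chr_vec_def herm_linear herm_same algebra_simps)
    then show ?thesis
      unfolding chr_vec_def[of p X] by (simp add: vec_eq_iff algebra_simps)
  qed
  \<comment> \<open>Since b + a b s = a^2, the coefficients of <X,p> <Z,p> Y and <Y,p> <Z,p> X are
    both 3 a^2: the part linear in X is symmetric in X and Y and drops out.\<close>
  have 4: "of_real (chr_a p) * (of_real (chr_a p) * x)
      = of_real (chr_b p) * x + of_real (chr_a p) *
          (of_real (chr_b p) * (of_real (p \<bullet> p) * x))" for x :: complex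
    using arg_cong[OF chr_b_chr_a[of p], of "\<lambda>t. of_real t * x"]
      by (simp add: algebra_simps power2_eq_square)
  note 5 = 4[of 1, simplified]
  show ?thesis
    unfolding curv_op_def 1 2 3
    by (simp add: vec_eq_iff chr_vec_def algebra_simps power2_eq_square 4 5)
qed

section \<open>Ricci curvature as a real trace\<close>

lemma sum_Basis_cvec:
  "(\<Sum>b\<in>(Basis :: (complex^'m) set). F b) = (\<Sum>i\<in>UNIV. F (axis i 1) + F (axis i \<i>))"
proof -
  have "(\<Sum>b\<in>(Basis :: (complex^'m) set). F b) = (\<Sum>b\<in>(\<Union>i\<in>UNIV. axis i ` {1, \<i>}). F b)"
    by (rule arg_cong[where f = "sum F"]) (auto simp: Basis_vec_def Basis_complex_def)
  also have "\<dots> = (\<Sum>i\<in>UNIV. \<Sum>b\<in>axis i ` {1, \<i>}. F b)"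
    by (subst sum.UNION_disjoint) (auto simp: axis_eq_axis)
  also have "\<dots> = (\<Sum>i\<in>UNIV. F (axis i 1) + F (axis i \<i>))"
    by (intro sum.cong refl) (auto simp: axis_eq_axis)
  finally show ?thesis .
qed

lemma herm_axis_left: "herm (axis i c) X = c * cnj (X $ i)"
  and herm_axis_right: "herm X (axis i c) = X $ i * cnj c"
proof -
  have "axis i c $ j = (if j = i then c else 0)" for j by (simp add: axis_def)
  then show "herm (axis i c) X = c * cnj (X $ i)" "herm X (axis i c) = X $ i * cnj c"
    by (simp_all add: herm_def if_distrib[of "\<lambda>x. x * _"] if_distrib[of cnj]
          if_distrib[of "(*) _"] cong: if_cong)
qed

definition real_trace :: "(complex^'m \<Rightarrow> complex^'m) \<Rightarrow> real" where
  "real_trace T = (\<Sum>b\<in>Basis. T b \<bullet> b)"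

lemma real_trace_add: "real_trace (\<lambda>X. S X + T X) = real_trace S + real_trace T"
  and real_trace_diff: "real_trace (\<lambda>X. S X - T X) = real_trace S - real_trace T"
  by (simp_all add: real_trace_def inner_add_left inner_diff_left sum.distrib sum_subtractf)

text \<open>The real trace of a complex linear map is twice the real part of its complex
  trace.\<close>

lemma real_trace_linear: "real_trace (\<lambda>X. (k * herm X U) *s V) = 2 * Re (k * herm V U)"
proof -
  have "real_trace (\<lambda>X. (k * herm X U) *s V) = (\<Sum>i\<in>UNIV. 2 * Re (k * (V $ i * cnj (U $ i))))"
    unfolding real_trace_def sum_Basis_cvec
    by (simp add: herm_vscale_left herm_axis_left herm_axis_right algebra_simps flip: Re_herm)
  then show ?thesis by (simp only: herm_def sum_distrib_left Re_sum)
qed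

text \<open>For a map that anticommutes with \<open>J\<close>, the basis vectors b and
  \<open>J\<close> b contribute opposite amounts.\<close>

lemma real_trace_antilinear: "real_trace (\<lambda>X. (k * herm U X) *s V) = 0"
  by (simp add: real_trace_def sum_Basis_cvec flip: Re_herm)
      (simp add: herm_axis_right algebra_simps)

lemma real_trace_scale: "real_trace (\<lambda>X. k *s (X :: complex^'m)) = 2 * CARD('m) * Re k"
  by (simp add: real_trace_def sum_Basis_cvec flip: Re_herm)
      (simp add: herm_axis_right algebra_simps)

text \<open>Of the two terms of the curvature operator, \<open>curv_part p X Y Y\<close> is
  antilinear in X and has trace 0; only \<open>curv_part p Y X Y\<close>, linear in X,
  contributes.\<close>

lemma ricci_root_metric:
  fixes p Y :: "complex^'m"
  defines "n \<equiv> real CARD('m) + 1"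
  shows "ricci root_metric p Y Y = - 2 * ((n * chr_a p + chr_b p * (p \<bullet> p)) * (Y \<bullet> Y)
    + (2 * n * (chr_a p)\<^sup>2 + chr_b_deriv p * (p \<bullet> p) + chr_b p) * (cmod (herm Y p))\<^sup>2)"
proof -
  have "real_trace (\<lambda>X. curv_part p X Y Y) = real_trace (\<lambda>X.
       ((4 * of_real ((chr_a p)\<^sup>2) * herm Y p) * herm p X) *s Y +
           ((2 * of_real (chr_a p)) * herm Y X) *s Y
     + ((of_real (chr_b_deriv p) * herm Y p * herm Y p) * herm p X) *s p +
         ((2 * of_real (chr_b p) * herm Y p) * herm Y X) *s p)"
    by (rule arg_cong[where f = real_trace])
        (simp add: fun_eq_iff vec_eq_iff curv_part_def algebra_simps)
  also have "\<dots> = 0" by (simp only: real_trace_add real_trace_antilinear)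
  finally have 1: "real_trace (\<lambda>X. curv_part p X Y Y) = 0" .
  have q: "herm p Y * herm Y p = of_real ((cmod (herm Y p))\<^sup>2)"
    by (metis cnj_herm complex_norm_square mult.commute)
  have "real_trace (\<lambda>X. curv_part p Y X Y) = real_trace (\<lambda>X.
       (2 * of_real ((chr_a p)\<^sup>2) * herm p Y * herm X p) *s Y + (of_real (chr_a p) * herm X Y) *s Y
     + (2 * of_real ((chr_a p)\<^sup>2) * (herm p Y * herm Y p) + of_real (chr_a p) * herm Y Y) *s X
     + ((of_real (chr_b_deriv p) * (herm p Y * herm Y p)) * herm X p) *s p +
         (of_real (chr_b p) * herm Y p * herm X Y) *s p
     + ((of_real (chr_b p) * herm Y Y) * herm X p) *s p)"
    by (rule arg_cong[where f = real_trace])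
        (simp add: fun_eq_iff vec_eq_iff curv_part_def algebra_simps)
  also have
      "\<dots> = 2 * Re (2 * of_real ((chr_a p)\<^sup>2) * (herm p Y * herm Y p))
          + 2 * Re (of_real (chr_a p) * herm Y Y)
     + 2 * CARD('m) * Re
         (2 * of_real ((chr_a p)\<^sup>2) * (herm p Y * herm Y p) + of_real (chr_a p) * herm Y Y)
     + 2 * Re (of_real (chr_b_deriv p) * (herm p Y * herm Y p) * herm p p) + 2 * Re
         (of_real (chr_b p) * (herm p Y * herm Y p))
     + 2 * Re (of_real (chr_b p) * herm Y Y * herm p p)"
    unfolding real_trace_add real_trace_scale real_trace_linear by (simp add: mult_ac)
  also have "\<dots> = 2 * ((n * chr_a p + chr_b p * (p \<bullet> p)) * (Y \<bullet> Y)
    + (2 * n * (chr_a p)\<^sup>2 + chr_b_deriv p * (p \<bullet> p) + chr_b p) * (cmod (herm Y p))\<^sup>2)"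
    unfolding q herm_same n_def
    by (simp add: algebra_simps)
  finally have 2: "real_trace (\<lambda>X. curv_part p Y X Y) = \<dots>" .
  have "ricci root_metric p Y Y = real_trace (\<lambda>X. curv_part p X Y Y - curv_part p Y X Y)"
    by (simp add: ricci_def real_trace_def curv_op_root_metric)
  then show ?thesis unfolding real_trace_diff 1 2 by simp
qed

text \<open>The Ricci form is affine in q, which ranges over [0, s y], so it suffices to treat both
  ends: Y orthogonal to p (\<open>A < 0\<close>) and Y in the complex line of p
  (\<open>A + B * s < 0\<close>).\<close>

lemma positive_ricci_root_metric:
  assumes "CARD('m::finite) \<ge> 2"
  shows "positive_ricci (root_metric :: (complex^'m) metric_tensor)"
  unfolding positive_ricci_def
proof (intro allI impI)
  fix p Y :: "complex^'m" assume "Y \<noteq> 0"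
  define n where "n = real CARD('m) + 1"
  define s where "s = p \<bullet> p"
  define y where "y = Y \<bullet> Y"
  define q where "q = (cmod (herm Y p))\<^sup>2"
  have y: "y > 0" and s: "s \<ge> 0" and n: "n \<ge> 3" using \<open>Y \<noteq> 0\<close> assms
    by (auto simp: y_def s_def n_def)
  have q: "q \<le> s * y" "q \<ge> 0" using herm_Cauchy_Schwarz[of Y p]
    by (auto simp: q_def s_def y_def mult.commute)
  define A where "A = n * chr_a p + chr_b p * s"
  define B where "B = 2 * n * (chr_a p)\<^sup>2 + chr_b_deriv p * s + chr_b p"
  have s': "1 + s > 0" "2 + s > 0" using s by auto
  have A: "A < 0"
  proof -
    have "A = (s - n * (2 + s)) / (2 * (1 + s) * (2 + s))"
      using s' by (simp add: A_def chr_a_def chr_b_def s_def[symmetric] divide_simps)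
    moreover have "s - n * (2 + s) < 0" using mult_right_mono[OF n, of "2 + s"] s' s
      by (simp add: algebra_simps)
    ultimately show ?thesis using s' by (simp add: divide_neg_pos)
  qed
  have AB: "A + B * s < 0"
  proof -
    have 1: "chr_a p * (1 + 2 * chr_a p * s) = - 1 / (2 * (1 + s)\<^sup>2)"
      using s' by (simp add: chr_a_def s_def[symmetric] divide_simps power2_eq_square)
          (simp add: algebra_simps)
    have 2: "2 * chr_b p + chr_b_deriv p * s = (4 + 3 * s) / (2 * (1 + s)\<^sup>2 * (2 + s)\<^sup>2)"
    proof -
      \<comment> \<open>Brings b to the denominator of b'; with x / 0 = 0 this holds for all u and
        v.\<close>
      have "1 / (2 * u * v) = u * v / (2 * u\<^sup>2 * v\<^sup>2)" for u v :: real
        by (simp add: power2_eq_square)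
      then have "chr_b p = (1 + s) * (2 + s) / (2 * (1 + s)\<^sup>2 * (2 + s)\<^sup>2)"
        unfolding chr_b_def s_def by blast
      then have "2 * chr_b p + chr_b_deriv p * s =
          (2 * ((1 + s) * (2 + s)) - (3 + 2 * s) * s) / (2 * (1 + s)\<^sup>2 * (2 + s)\<^sup>2)"
        unfolding chr_b_deriv_def s_def[symmetric]
        by (simp only: times_divide_eq_left times_divide_eq_right diff_divide_distrib
              minus_divide_left
            mult_minus_left)
      also have "2 * ((1 + s) * (2 + s)) - (3 + 2 * s) * s = 4 + 3 * s"
        by (simp add: algebra_simps)
      finally show ?thesis .
    qed
    have "A + B * s = n * (chr_a p * (1 + 2 * chr_a p * s)) + s * (2 * chr_b p + chr_b_deriv p * s)"
      by (simp add: A_def B_def algebra_simps power2_eq_square)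
    also have "\<dots> = (s * (4 + 3 * s) - n * (2 + s)\<^sup>2) / (2 * (1 + s)\<^sup>2 * (2 + s)\<^sup>2)"
      unfolding 1 2 using s' by (simp add: divide_simps)
    finally have "A + B * s = \<dots>" .
    \<comment> \<open>Here the dimension matters: n = 3 leaves the margin 12 + 8 s, whereas n = 2,
      that is m = 1, would give 8 + 4 s - s^2, the sign of the radial holomorphic curvature.\<close>
    moreover have "s * (4 + 3 * s) - n * (2 + s)\<^sup>2 < 0"
    proof -
      have "3 * (2 + s)\<^sup>2 - s * (4 + 3 * s) = 12 + 8 * s"
        by (simp add: power2_eq_square algebra_simps)
      then show ?thesis using mult_right_mono[OF n, of "(2 + s)\<^sup>2"] s
        by (smt (verit) zero_le_power2)
    qed
    ultimately show ?thesis using s' by (simp add: divide_neg_pos)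
  qed
  have "A * y + B * q < 0"
  proof (cases "B \<le> 0")
    case True
    then show ?thesis using A y q by (smt (verit) mult_neg_pos mult_nonpos_nonneg)
  next
    case False
    then have "A * y + B * q \<le> (A + B * s) * y"
      using mult_left_mono[OF q(1), of B] by (simp add: algebra_simps)
    then show ?thesis using AB y by (smt (verit) mult_neg_pos)
  qed
  moreover have "ricci root_metric p Y Y = - 2 * (A * y + B * q)"
    unfolding ricci_root_metric A_def B_def y_def q_def s_def n_def ..
  ultimately show "ricci root_metric p Y Y > 0" by simp
qed

section \<open>Orthogonal bisectional curvature\<close>

definition root_herm :: "complex^'m \<Rightarrow> complex^'m \<Rightarrow> complex^'m \<Rightarrow> complex" where
  "root_herm p X Y = of_real (weight p) * herm X Y
      - of_real (weight p ^ 3 / 2) * (herm X p * herm p Y)"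

lemma root_metric_eq_Re_root_herm: "root_metric p X Y = Re (root_herm p X Y)"
  by (simp add: root_metric_def root_herm_def Re_herm)

lemma root_herm_vscale_left: "root_herm p (c *s X) Y = c * root_herm p X Y"
  and root_herm_vscale_right: "root_herm p X (c *s Y) = cnj c * root_herm p X Y"
  by (simp_all add: root_herm_def herm_linear algebra_simps)

lemma root_herm_minus_left: "root_herm p (- X) Y = - root_herm p X Y"
  and root_herm_diff_left: "root_herm p (X - Z) Y = root_herm p X Y - root_herm p Z Y"
  by (simp_all add: root_herm_def herm_linear algebra_simps)

lemma curv_part_vscale: "curv_part p (c *s X) Y Z = cnj c *s curv_part p X Y Z"
  "curv_part p X (c *s Y) Z = c *s curv_part p X Y Z"
  "curv_part p X Y (c *s Z) = c *s curv_part p X Y Z"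
  by (simp_all add: curv_part_def herm_linear vec_eq_iff algebra_simps)

lemma type_1_0_iff: "type_1_0 Z \<longleftrightarrow> snd Z = - (J (fst Z))"
proof -
  have "J (- (J X)) = X" for X :: "complex^'m" by (simp add: vec_eq_iff mult.assoc[symmetric])
  then show ?thesis by (auto simp: type_1_0_def)
qed

lemma uminus_J: "- (J X) = (- \<i>) *s X" by (simp add: vec_eq_iff)

text \<open>On the vector \<open>X - \<i> J X\<close> of type (1,0), the complex extension of a complex linear map
  doubles its value at \<open>X\<close>, and that of an antilinear map vanishes; so only one of the four
  terms of \<open>g (R(X,Y)Z) W\<close> survives, with the factor \<open>-16/2\<close>.\<close>

lemma bisect_curv_root_metric:
  assumes "type_1_0 Z" "type_1_0 W"
  shows "bisect_curv root_metric p Z W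
      = - 8 * root_herm p (curv_part p (fst Z) (fst Z) (fst W)) (fst W)"
proof -
  obtain X Y where Z: "Z = (X, (- \<i>) *s X)" and W: "W = (Y, (- \<i>) *s Y)"
    using assms unfolding type_1_0_iff uminus_J by (metis prod.collapse)
  have [simp]: "- ((- \<i>) *s V) = \<i> *s V" for V :: "complex^'m" by (simp add: vec_eq_iff)
  show ?thesis
    unfolding bisect_curv_def ccurv_def cext_def conj_vec_def Z W fst_conv snd_conv
      curv_def curv_op_root_metric root_metric_eq_Re_root_herm root_herm_diff_left
      curv_part_vscale root_herm_vscale_left root_herm_vscale_right
    by (simp add: complex_eq_iff curv_part_vscale root_herm_vscale_left root_herm_vscale_right
          root_herm_minus_left)
qed

lemma cmetric_root_metric:
  assumes "type_1_0 Z" "type_1_0 W"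
  shows "cmetric root_metric p Z (conj_vec W) = 2 * root_herm p (fst Z) (fst W)"
proof -
  obtain X Y where Z: "Z = (X, (- \<i>) *s X)" and W: "W = (Y, (- \<i>) *s Y)"
    using assms unfolding type_1_0_iff uminus_J by (metis prod.collapse)
  have [simp]: "- ((- \<i>) *s V) = \<i> *s V" for V :: "complex^'m" by (simp add: vec_eq_iff)
  show ?thesis
    unfolding cmetric_def cext_def conj_vec_def Z W fst_conv snd_conv
      root_metric_eq_Re_root_herm root_herm_vscale_left root_herm_vscale_right
    by (simp add: complex_eq_iff curv_part_vscale root_herm_vscale_left root_herm_vscale_right
          root_herm_minus_left)
qed

lemma root_herm_chr_a:
    "root_herm p X Y = of_real (weight p) * (herm X Y + of_real (chr_a p) * (herm X p * herm p Y))"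
  by (simp add: root_herm_def chr_a_weight algebra_simps eval_nat_numeral)

text \<open>Orthogonality expresses <X,Y> as -a <X,p> <p,Y>. All phases then pair up to P and Q, so
  the value is real.\<close>

lemma root_herm_curv_part_orthogonal:
  assumes "root_herm p X Y = 0"
  defines "P \<equiv> (cmod (herm X p))\<^sup>2" and "Q \<equiv> (cmod (herm Y p))\<^sup>2"
  shows "root_herm p (curv_part p X X Y) Y = of_real (weight p * (chr_a p * ((X \<bullet> X) * (Y \<bullet> Y))
     + 2 * (chr_a p)\<^sup>2 * (P * (Y \<bullet> Y) + (X \<bullet> X) * Q)
     + (chr_a p ^ 3 + chr_b_deriv p * (1 + chr_a p * (p \<bullet> p))) * (P * Q)))"
proof -
  have k: "herm X Y = - of_real (chr_a p) * (herm X p * herm p Y)"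
    using assms(1) weight_pos[of p] by (simp add: root_herm_chr_a add_eq_0_iff)
  have k': "herm Y X = - of_real (chr_a p) * (herm p X * herm Y p)"
    using arg_cong[OF k, of cnj] by (simp add: cnj_herm)
  have norm: "herm V p * herm p V = of_real ((cmod (herm V p))\<^sup>2)" for V
    by (simp only: complex_norm_square cnj_herm)
  have P: "herm X p * herm p X = of_real P" "herm X p * (herm p X * z) = of_real P * z"
     "herm p X * herm X p = of_real P" "herm p X * (herm X p * z) = of_real P * z" for z
    using norm[of X] by (simp_all add: P_def mult.commute[of "herm p X"] mult.assoc[symmetric])
  have Q: "herm Y p * herm p Y = of_real Q" "herm Y p * (herm p Y * z) = of_real Q * z"
     "herm p Y * herm Y p = of_real Q" "herm p Y * (herm Y p * z) = of_real Q * z" for z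
    using norm[of Y] by (simp_all add: Q_def mult.commute[of "herm p Y"] mult.assoc[symmetric])
  have S: "herm (curv_part p X X Y) V =
     (2 * of_real ((chr_a p)\<^sup>2) * of_real P + of_real (chr_a p) * of_real (X \<bullet> X)) * herm Y V
   + (2 * of_real ((chr_a p)\<^sup>2) * (herm p X * herm Y p) + of_real (chr_a p) * herm Y X) * herm X V
   + (of_real (chr_b_deriv p) * of_real P * herm Y p
      + of_real (chr_b p) * (of_real (X \<bullet> X) * herm Y p + herm X p * herm Y X)) * herm p V" for V
    by (simp add: curv_part_def herm_linear herm_same P mult.assoc) (simp add: algebra_simps)
  have PQ: "herm X p * (herm Y p * (herm p X * herm p Y)) = of_real P * of_real Q"
    using arg_cong2[OF P(1) Q(1), of "(*)"] by (simp add: mult_ac)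
  have PY: "herm X p * (herm Y p * (herm p X * z)) = of_real P * (herm Y p * z)" for z
    using arg_cong[OF P(1), of "\<lambda>w. w * (herm Y p * z)"] by (simp add: mult_ac)
  have 1: "herm (curv_part p X X Y) Y = of_real ((2 * (chr_a p)\<^sup>2 * P + chr_a p * (X \<bullet> X)) * (Y \<bullet> Y)
     - chr_a p ^ 3 * P * Q + chr_b_deriv p * P * Q + chr_b p * ((X \<bullet> X) * Q - chr_a p * P * Q))"
    unfolding S k k' herm_same
    by (simp add: algebra_simps P Q PQ eval_nat_numeral)
  have 2: "herm (curv_part p X X Y) p = of_real (2 * (chr_a p)\<^sup>2 * P + chr_a p * (X \<bullet> X)
     + (chr_a p)\<^sup>2 * P + chr_b_deriv p * P * (p \<bullet> p) + chr_b p * ((X \<bullet> X) - chr_a p * P) *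
         (p \<bullet> p)) * herm Y p"
    unfolding S k k' herm_same
    by (simp add: algebra_simps P Q PY eval_nat_numeral)
  \<comment> \<open>Combines the products with Y and with p according to
    \<open>root_herm_chr_a\<close>; the relation between a and b eliminates b.\<close>
  have poly: "(2 * a\<^sup>2 * P + a * x) * y - a ^ 3 * P * Q + d * P * Q + b * (x * Q - a * P * Q)
      + a * ((2 * a\<^sup>2 * P + a * x + a\<^sup>2 * P + d * P * s + b * (x - a * P) * s) * Q)
    = a * (x * y) + 2 * a\<^sup>2 * (P * y + x * Q) + (a ^ 3 + d * (1 + a * s)) * (P * Q)"
    if "b * (1 + a * s) = a\<^sup>2" for a b d s x y :: real
    using that by algebra
  show ?thesis
    unfolding root_herm_chr_a 1 2 poly[OF chr_b_chr_a, symmetric] by (simp add: mult.assoc Q)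
qed

text \<open>Here \<open>x = |X|\<^sup>2\<close>, \<open>y = |Y|\<^sup>2\<close>, \<open>P = |\<langle>X,p\<rangle>|\<^sup>2\<close>, \<open>Q = |\<langle>Y,p\<rangle>|\<^sup>2\<close>, and \<open>gram\<close> is the Gram
  inequality of \<open>X\<close>, \<open>Y\<close>, \<open>p\<close> for \<open>g\<close>-orthogonal \<open>X\<close> and \<open>Y\<close>.\<close>

lemma bisectional_polynomial_pos:
  fixes x y P Q s :: real
  assumes s: "s > 0" and x: "x > 0" and y: "y > 0" and PQ: "0 \<le> P" "0 \<le> Q" "P \<le> s * x" "Q \<le> s * y"
    and gram: "P * Q * ((2 + s) / (2 * (1 + s)))\<^sup>2 \<le> (s * x - P) * (s * y - Q)"
  shows "x * y - (P * y + x * Q) / (1 + s)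
     + (1 / (4 * (1 + s)\<^sup>2) + (3 + 2 * s) / (2 * (1 + s)\<^sup>2 * (2 + s))) * (P * Q) > 0" (is "?E > 0")
proof -
  \<comment> \<open>u and v are s times the squared norms of the components of X and Y orthogonal to
    p, and t = 1 + a s. Multiplying by s^2 allows x and y to be replaced by u + P and v + Q.\<close>
  define u where "u = s * x - P"
  define v where "v = s * y - Q"
  define t where "t = (2 + s) / (2 * (1 + s))"
  define \<kappa> where "\<kappa> = 1 / (4 * (1 + s)\<^sup>2) + (3 + 2 * s) / (2 * (1 + s)\<^sup>2 * (2 + s))"
  have uv: "u \<ge> 0" "v \<ge> 0" using PQ by (auto simp: u_def v_def)
  have g: "P * Q * t\<^sup>2 \<le> u * v" using gram by (simp add: u_def v_def t_def)
  have E: "s\<^sup>2 * ?E = u * v + (P * v + u * Q) / (1 + s) + (1 - 2 * s / (1 + s) + s\<^sup>2 * \<kappa>) * (P * Q)"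
  proof -
    have sx: "s * x = u + P" and sy: "s * y = v + Q" by (simp_all add: u_def v_def)
    have "s\<^sup>2 * ?E = (s * x) * (s * y) - s / (1 + s) * (P * (s * y) + (s * x) * Q)
        + s\<^sup>2 * \<kappa> * (P * Q)"
      unfolding \<kappa>_def[symmetric]
      by (simp add: algebra_simps add_divide_distrib power2_eq_square)
    also have
        "\<dots> = (u + P) * (v + Q) - s / (1 + s) * (P * (v + Q) + (u + P) * Q) + s\<^sup>2 * \<kappa> * (P * Q)"
      unfolding sx sy ..
    also have "\<dots> = u * v + (P * v + u * Q) / (1 + s) + (1 - 2 * s / (1 + s) + s\<^sup>2 * \<kappa>) * (P * Q)"
    proof -
      define r where "r = 1 / (1 + s)"
      have r: "s / (1 + s) = 1 - r" "2 * s / (1 + s) = 2 - 2 * r"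
        using s by (simp_all add: r_def field_simps)
      have r': "z / (1 + s) = z * r" for z by (simp add: r_def)
      show ?thesis unfolding r unfolding r' by (simp add: algebra_simps)
    qed
    finally show ?thesis .
  qed
  have "s\<^sup>2 * ?E > 0"
  proof (cases "P * Q = 0")
    case True
    \<comment> \<open>Strictness has to come from u and v: if P = 0, then u = s x > 0 and v + Q = s
      y > 0; likewise for Q = 0.\<close>
    then consider "P = 0" | "Q = 0" by auto
    then show ?thesis
    proof cases
      case 1
      have "u > 0" using 1 s x by (simp add: u_def)
      moreover have "v > 0 \<or> Q > 0" using mult_pos_pos[OF s y] uv PQ by (auto simp: v_def)
      ultimately have "u * (v + Q / (1 + s)) > 0" using uv PQ s
        by (intro mult_pos_pos) (auto intro: add_pos_nonneg add_nonneg_pos)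
      then show ?thesis unfolding E using 1 by (simp add: algebra_simps)
    next
      case 2
      have "v > 0" using 2 s y by (simp add: v_def)
      moreover have "u > 0 \<or> P > 0" using mult_pos_pos[OF s x] uv PQ by (auto simp: u_def)
      ultimately have "v * (u + P / (1 + s)) > 0" using uv PQ s
        by (intro mult_pos_pos) (auto intro: add_pos_nonneg add_nonneg_pos)
      then show ?thesis unfolding E using 2 by (simp add: algebra_simps)
    qed
  next
    case False
    then have pq: "P * Q > 0" using PQ by (simp add: less_le)
    \<comment> \<open>Arithmetic-geometric mean inequality for P v and u Q, combined with the Gram
      bound on u v.\<close>
    have "(2 * t * (P * Q))\<^sup>2 = 4 * (P * Q) * (P * Q * t\<^sup>2)" by (simp add: power2_eq_square)
    also have "\<dots> \<le> 4 * (P * Q) * (u * v)" using g pq by (intro mult_left_mono) auto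
    also have "\<dots> \<le> (P * v + u * Q)\<^sup>2"
      using zero_le_power2[of "P * v - u * Q"] by (simp add: power2_eq_square algebra_simps)
    finally have amgm: "2 * t * (P * Q) \<le> P * v + u * Q"
      by (rule power2_le_imp_le) (use PQ uv in auto)
    \<comment> \<open>The coefficient of P Q left after bounding u v below by t^2 P Q and P v + u Q
      by 2 t P Q; its numerator has only positive coefficients.\<close>
    define c where "c = t\<^sup>2 + 2 * t / (1 + s) + (1 - 2 * s / (1 + s) + s\<^sup>2 * \<kappa>)"
    have "c = (32 + 32 * s + 10 * s\<^sup>2 + 2 * s ^ 3) / (4 * (1 + s)\<^sup>2 * (2 + s))"
    proof -
      have n: "1 + s \<noteq> 0" "2 + s \<noteq> 0" using s by auto
      have tt: "2 * (1 + s) * t = 2 + s" using n by (simp add: t_def)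
      have "4 * (1 + s)\<^sup>2 * (2 + s) * t\<^sup>2 = (2 * (1 + s) * t)\<^sup>2 * (2 + s)"
        by (simp add: power2_eq_square algebra_simps)
      then have "4 * (1 + s)\<^sup>2 * (2 + s) * t\<^sup>2 = (2 + s) ^ 3"
        unfolding tt by (simp add: power2_eq_square power3_eq_cube)
      moreover
      have "4 * (1 + s)\<^sup>2 * (2 + s) * (2 * t / (1 + s)) = 4 * (2 + s) * (2 * (1 + s) * t)"
        using n by (simp add: power2_eq_square) (simp add: algebra_simps)
      hence "4 * (1 + s)\<^sup>2 * (2 + s) * (2 * t / (1 + s)) = 4 * (2 + s)\<^sup>2"
        unfolding tt by (simp add: power2_eq_square)
      moreover have
          "4 * (1 + s)\<^sup>2 * (2 + s) * (1 - 2 * s / (1 + s)) = 4 * (1 - s) * (1 + s) * (2 + s)"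
        using n by (simp add: field_simps eval_nat_numeral)
      moreover have "4 * (1 + s)\<^sup>2 * (2 + s) * (s\<^sup>2 * \<kappa>) = s\<^sup>2 * (2 + s) + 2 * s\<^sup>2 * (3 + 2 * s)"
      proof -
        have "4 * u\<^sup>2 * v * (1 / (4 * u\<^sup>2) + w / (2 * u\<^sup>2 * v)) = v + 2 * w"
          if "u \<noteq> 0" "v \<noteq> 0" for u v w :: real
          using that by (simp add: field_simps)
        from this[OF n, of "3 + 2 * s"]
        have "4 * (1 + s)\<^sup>2 * (2 + s) * \<kappa> = (2 + s) + 2 * (3 + 2 * s)"
          unfolding \<kappa>_def[symmetric] .
        then have "s\<^sup>2 * (4 * (1 + s)\<^sup>2 * (2 + s) * \<kappa>) = s\<^sup>2 * ((2 + s) + 2 * (3 + 2 * s))"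
          by (rule arg_cong)
        then show ?thesis by (simp only: mult_ac distrib_left)
      qed
      ultimately have "4 * (1 + s)\<^sup>2 * (2 + s) * c = 32 + 32 * s + 10 * s\<^sup>2 + 2 * s ^ 3"
        unfolding c_def distrib_left[of "4 * (1 + s)\<^sup>2 * (2 + s)"]
          by (simp add: algebra_simps eval_nat_numeral)
      then show ?thesis using n by (simp add: nonzero_eq_divide_eq mult.commute)
    qed
    then have "c > 0" using s by (auto intro!: divide_pos_pos add_pos_pos mult_pos_pos)
    then have "0 < c * (P * Q)" using pq by simp
    also have
        "\<dots> = P * Q * t\<^sup>2 + 2 * t * (P * Q) / (1 + s) + (1 - 2 * s / (1 + s) + s\<^sup>2 * \<kappa>) * (P * Q)"
      by (simp add: c_def algebra_simps)
    also have "\<dots> \<le> s\<^sup>2 * ?E"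
      unfolding E using g amgm s by (intro add_mono divide_right_mono) auto
    finally show ?thesis .
  qed
  then show ?thesis using s by (simp add: zero_less_mult_iff)
qed

text \<open>Cauchy-Schwarz for the projections of X and Y to the complement of p. They are scaled by
  s to avoid division, and the resulting factor s^2 is cancelled.\<close>

lemma gram_inequality:
  fixes p X Y :: "complex^'m"
  assumes "p \<noteq> 0"
  defines "s \<equiv> p \<bullet> p"
  shows "(cmod (of_real s * herm X Y - herm X p * herm p Y))\<^sup>2
     \<le> (s * (X \<bullet> X) - (cmod (herm X p))\<^sup>2) * (s * (Y \<bullet> Y) - (cmod (herm Y p))\<^sup>2)"
proof -
  have s: "s > 0" using assms by simp
  define pr where "pr V = of_real s *s V - herm V p *s p" for V
  have herm_pr: "herm (pr V) (pr W) = of_real s * (of_real s * herm V W - herm V p * herm p W)"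
    for V W
    by (simp add: pr_def herm_linear herm_same cnj_herm s_def algebra_simps)
  have norm: "herm V p * herm p V = of_real ((cmod (herm V p))\<^sup>2)" for V
    by (simp only: complex_norm_square cnj_herm)
  have inner_pr: "pr V \<bullet> pr V = s * (s * (V \<bullet> V) - (cmod (herm V p))\<^sup>2)" for V
  proof -
    have "pr V \<bullet> pr V = Re (of_real s * (of_real s * herm V V - herm V p * herm p V))"
      unfolding herm_pr[symmetric] by (simp add: Re_herm)
    then show ?thesis unfolding norm herm_same by simp
  qed
  have "(cmod (herm (pr X) (pr Y)))\<^sup>2 = s\<^sup>2 * (cmod (of_real s * herm X Y - herm X p * herm p Y))\<^sup>2"
    unfolding herm_pr by (simp add: norm_mult power_mult_distrib)
  then have "s\<^sup>2 * (cmod (of_real s * herm X Y - herm X p * herm p Y))\<^sup>2 \<le>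
      s\<^sup>2 * ((s * (X \<bullet> X) - (cmod (herm X p))\<^sup>2) * (s * (Y \<bullet> Y) - (cmod (herm Y p))\<^sup>2))"
    using herm_Cauchy_Schwarz[of "pr X" "pr Y"] unfolding inner_pr
    by (simp add: power2_eq_square mult_ac)
  then show ?thesis using s by (simp add: mult_le_cancel_left_pos)
qed

text \<open>Factoring out \<open>weight p * chr_a p\<close>, which is negative, leaves the
  polynomial e of the previous estimate, or x y when p = 0. The factor -8 in
  \<open>bisect_curv_root_metric\<close> turns this sign into positive curvature.\<close>

lemma root_herm_curv_part_neg:
  assumes "root_herm p X Y = 0" "X \<noteq> 0" "Y \<noteq> 0"
  obtains c where "c < 0" "root_herm p (curv_part p X X Y) Y = of_real c"
proof -
  define s where "s = p \<bullet> p"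
  define x where "x = X \<bullet> X"
  define y where "y = Y \<bullet> Y"
  define P where "P = (cmod (herm X p))\<^sup>2"
  define Q where "Q = (cmod (herm Y p))\<^sup>2"
  have x: "x > 0" and y: "y > 0" using assms by (auto simp: x_def y_def)
  have PQ: "0 \<le> P" "0 \<le> Q" "P \<le> s * x" "Q \<le> s * y"
    using herm_Cauchy_Schwarz[of X p] herm_Cauchy_Schwarz[of Y p]
    by (auto simp: P_def Q_def s_def x_def y_def mult.commute)
  have s': "1 + s > 0" "2 + s > 0" by (simp_all add: s_def add_pos_nonneg)
  define e where "e = x * y - (P * y + x * Q) / (1 + s)
     + (1 / (4 * (1 + s)\<^sup>2) + (3 + 2 * s) / (2 * (1 + s)\<^sup>2 * (2 + s))) * (P * Q)"
  have "e > 0"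
  proof (cases "p = 0")
    case True
    then show ?thesis using x y by (simp add: e_def P_def Q_def herm_def)
  next
    case False
    then have s: "s > 0" by (simp add: s_def)
    have k: "herm X Y = - of_real (chr_a p) * (herm X p * herm p Y)"
      using assms(1) weight_pos[of p] by (simp add: root_herm_chr_a add_eq_0_iff)
    have "of_real s * herm X Y - herm X p * herm p Y
        = - of_real (1 + s * chr_a p) * (herm X p * herm p Y)"
      unfolding k by (simp add: algebra_simps)
    moreover have "1 + s * chr_a p = (2 + s) / (2 * (1 + s))"
      using s' by (simp add: chr_a_def s_def[symmetric] divide_simps)
    moreover have "cmod (herm p Y) = cmod (herm Y p)" by (metis cnj_herm complex_mod_cnj)
    moreover have "(cmod (- of_real t * (a * b)))\<^sup>2 = (cmod a)\<^sup>2 * (cmod b)\<^sup>2 * t\<^sup>2" for t a b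
      by (simp add: norm_mult power_mult_distrib)
    ultimately have
        "(cmod (of_real s * herm X Y - herm X p * herm p Y))\<^sup>2
            = P * Q * ((2 + s) / (2 * (1 + s)))\<^sup>2"
      unfolding P_def Q_def by (simp only:)
    then have "P * Q * ((2 + s) / (2 * (1 + s)))\<^sup>2 \<le> (s * x - P) * (s * y - Q)"
      using gram_inequality[OF False, of X Y] by (simp add: s_def x_def y_def P_def Q_def)
    from bisectional_polynomial_pos[OF s x y PQ this] show ?thesis by (simp add: e_def)
  qed
  have chr_a: "chr_a p < 0" using s' by (simp add: chr_a_def s_def)
  have chr_b_deriv:
      "chr_b_deriv p * (1 + chr_a p * s) = chr_a p * ((3 + 2 * s) / (2 * (1 + s)\<^sup>2 * (2 + s)))"
  proof -
    have "- w / (2 * u\<^sup>2 * v\<^sup>2) * (v / (2 * u)) = (- 1 / (2 * u)) * (w / (2 * u\<^sup>2 * v))"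
      if "u \<noteq> 0" "v \<noteq> 0" for u v w :: real using that by (simp add: field_simps power2_eq_square)
    from this[of "1 + s" "2 + s" "3 + 2 * s"] s'
    have "chr_b_deriv p * ((2 + s) / (2 * (1 + s)))
        = chr_a p * ((3 + 2 * s) / (2 * (1 + s)\<^sup>2 * (2 + s)))"
      unfolding chr_b_deriv_def chr_a_def s_def[symmetric] by (metis less_irrefl)
    moreover have "1 + chr_a p * s = (2 + s) / (2 * (1 + s))"
      using s' by (simp add: chr_a_def s_def[symmetric] divide_simps)
    ultimately show ?thesis by (simp only:)
  qed
  have "2 * (- 1 / (2 * u)) = - (1 / u)" "(- 1 / (2 * u))\<^sup>2 = 1 / (4 * u\<^sup>2)" for u :: real
    by (simp_all add: power_divide power_mult_distrib)
  then have a2: "2 * chr_a p = - (1 / (1 + s))" "(chr_a p)\<^sup>2 = 1 / (4 * (1 + s)\<^sup>2)"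
    unfolding chr_a_def s_def by blast+
  have "chr_a p * e = chr_a p * (x * y) + chr_a p * (2 * chr_a p) * (P * y + x * Q)
     + (chr_a p * (chr_a p)\<^sup>2 + chr_b_deriv p * (1 + chr_a p * s)) * (P * Q)"
    unfolding a2 chr_b_deriv e_def by (simp add: algebra_simps add_divide_distrib)
  then have "root_herm p (curv_part p X X Y) Y = of_real (weight p * (chr_a p * e))"
    unfolding root_herm_curv_part_orthogonal[OF assms(1)]
    by (simp add: x_def y_def P_def Q_def s_def power2_eq_square power3_eq_cube mult.left_commute)
  moreover have "weight p * (chr_a p * e) < 0"
    using chr_a \<open>e > 0\<close> weight_pos[of p] by (simp add: mult_neg_pos mult_pos_neg)
  ultimately show ?thesis using that by blast
qed

lemma positive_orthogonal_bisect_root_metric: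
    "positive_orthogonal_bisect_curv (root_metric :: (complex^'m) metric_tensor)"
  unfolding positive_orthogonal_bisect_curv_def
proof (intro allI impI, elim conjE)
  fix p :: "complex^'m" and Z W
  assume *: "type_1_0 Z" "type_1_0 W" "Z \<noteq> 0" "W \<noteq> 0" "cmetric root_metric p Z (conj_vec W) = 0"
  then have "fst Z \<noteq> 0" "fst W \<noteq> 0" by (auto simp: type_1_0_iff prod_eq_iff)
  moreover have "root_herm p (fst Z) (fst W) = 0" using * cmetric_root_metric[of Z W p] by simp
  ultimately obtain c where "c < 0"
      "root_herm p (curv_part p (fst Z) (fst Z) (fst W)) (fst W) = of_real c"
    using root_herm_curv_part_neg by blast
  then show "bisect_curv root_metric p Z W > 0"
    using bisect_curv_root_metric[OF *(1,2), of p] by (simp add: less_complex_def)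
qed

section \<open>Negative holomorphic sectional curvature in a radial direction\<close>

lemma hol_sect_curv_negative_root_metric:
    "hol_sect_curv_negative_somewhere (root_metric :: (complex^'m) metric_tensor)"
proof -
  \<comment> \<open>8 + 4 s - s^2 is negative once s > 2 + 2 sqrt 3; s = 9 is a perfect square
    beyond this bound. Its value -37 reappears as 333 = 9 * 37 below.\<close>
  define p :: "complex^'m" where "p = axis undefined 3"
  have pp: "p \<bullet> p = 9" by (simp add: p_def inner_axis_axis inner_complex_def)
  have h: "herm p p = 9" by (simp add: herm_same pp)
  have c: "chr_a p = - 1 / 20" "chr_b p = 1 / 220" "chr_b_deriv p = - 21 / 24200"
    by (simp_all add: chr_a_def chr_b_def chr_b_deriv_def pp)
  have root_herm: "root_herm p (c *s p) p = of_real (weight p) * (c * 99 / 20)" for c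
    by (simp add: root_herm_chr_a herm_linear h c(1) algebra_simps)
  define Z where "Z = (p, - (J p))"
  have Z: "type_1_0 Z" by (simp add: type_1_0_iff Z_def)
  have "curv_part p p p p = (2 * (2 * of_real ((chr_a p)\<^sup>2) * 81 + of_real (chr_a p) * 9)
       + (of_real (chr_b_deriv p) * 729 + of_real (chr_b p) * 162)) *s p"
    unfolding curv_part_def h by (simp add: vec_eq_iff algebra_simps)
  then have "root_herm p (curv_part p p p p) p = of_real (weight p * (99 / 20 * (333 / 24200)))"
    by (simp only: root_herm) (simp add: c power2_eq_square)
  moreover have "hol_sect_curv root_metric p Z = bisect_curv root_metric p Z Z"
    by (simp add: hol_sect_curv_def bisect_curv_def)
  moreover have "bisect_curv root_metric p Z Z = - 8 * root_herm p (curv_part p p p p) p"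
    using bisect_curv_root_metric[OF Z Z, of p] by (simp only: Z_def fst_conv)
  ultimately have
      "hol_sect_curv root_metric p Z = of_real (- 8 * (weight p * (99 / 20 * (333 / 24200))))"
    by (simp only: of_real_mult of_real_minus of_real_numeral)
  then have "hol_sect_curv root_metric p Z < 0"
    using weight_pos[of p] by (simp add: less_complex_def del: of_real_mult)
  then show ?thesis using Z unfolding hol_sect_curv_negative_somewhere_def by blast
qed

subsection \<open>Completeness\<close>

text \<open>The square of the factor is the constant of \<open>root_metric_lower\<close>. The norm
  of the image grows like sqrt |p|, the same order as the length of a ray.\<close>

definition short_map :: "complex^'m \<Rightarrow> complex^'m" where
  "short_map p = sqrt (weight p / 2) *\<^sub>R p"

definition short_map_deriv :: "complex^'m \<Rightarrow> complex^'m \<Rightarrow> complex^'m" where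
  "short_map_deriv p X = sqrt (weight p / 2) *\<^sub>R (X - ((weight p)\<^sup>2 / 2 * (p \<bullet> X)) *\<^sub>R p)"

lemma has_derivative_short_map: "(short_map has_derivative short_map_deriv p) (at p)"
proof -
  have "((\<lambda>p. sqrt (weight p / 2)) has_derivative
      (\<lambda>X. - ((weight p)\<^sup>2 / 2 * (p \<bullet> X)) * sqrt (weight p / 2))) (at p)"
  proof (rule has_derivative_eq_rhs)
    show "((\<lambda>p. sqrt (weight p / 2)) has_derivative
        (\<lambda>X. (- (p \<bullet> X) * weight p ^ 3 / 2) * (inverse (sqrt (weight p / 2)) / 2))) (at p)"
      by (rule has_derivative_real_sqrt[OF _ bounded_linear.has_derivative[OF
            bounded_linear_divide has_derivative_weight]])
        (use weight_pos[of p] in simp)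
    have w: "weight p / 2 = sqrt (weight p / 2) * sqrt (weight p / 2)" and nz:
        "sqrt (weight p / 2) \<noteq> 0"
      using weight_pos[of p] by simp_all
    have "weight p ^ 3 / 2 = (weight p)\<^sup>2 * (weight p / 2)"
      by (simp add: eval_nat_numeral)
    also have "\<dots> * (inverse (sqrt (weight p / 2)) / 2) = (weight p)\<^sup>2 / 2 * sqrt (weight p / 2)"
      by (subst w) (use nz in \<open>simp add: field_simps del: real_sqrt_mult_self\<close>)
    finally have *:
        "weight p ^ 3 / 2 * (inverse (sqrt (weight p / 2)) / 2)
            = (weight p)\<^sup>2 / 2 * sqrt (weight p / 2)" .
    have "- (p \<bullet> X) * weight p ^ 3 / 2 * (inverse (sqrt (weight p / 2)) / 2)
        = - (p \<bullet> X) * (weight p ^ 3 / 2 * (inverse (sqrt (weight p / 2)) / 2))" for X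
      by simp
    then show "(\<lambda>X. (- (p \<bullet> X) * weight p ^ 3 / 2) * (inverse (sqrt (weight p / 2)) / 2))
        = (\<lambda>X. - ((weight p)\<^sup>2 / 2 * (p \<bullet> X)) * sqrt (weight p / 2))"
      unfolding * by (simp add: fun_eq_iff)
  qed
  from has_derivative_scaleR[OF this has_derivative_ident]
  show ?thesis
    unfolding short_map_def[abs_def]
      by (rule has_derivative_eq_rhs) (simp add: fun_eq_iff short_map_deriv_def algebra_simps)
qed

text \<open>Subtracting c (p . X) p from X does not increase its norm as long as 0 \<le> c and c
  |p|^2 \<le> 2; the remaining factor is the lower bound of the metric.\<close>

lemma norm_short_map_deriv: "norm (short_map_deriv p X) \<le> sqrt (root_metric p X X)"
proof (rule real_le_rsqrt)
  define c where "c = (weight p)\<^sup>2 / 2"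
  have c: "c \<ge> 0" "c * (p \<bullet> p) \<le> 2"
    using inner_ge_zero[of p] by (auto simp: c_def weight_square divide_simps add_pos_nonneg)
  have "(norm (X - (c * (p \<bullet> X)) *\<^sub>R p))\<^sup>2 = X \<bullet> X - c * (2 - c * (p \<bullet> p)) * (p \<bullet> X)\<^sup>2"
    unfolding power2_norm_eq_inner
    by (simp add: inner_diff_left inner_diff_right inner_commute[of X p] power2_eq_square
          algebra_simps)
  also have "\<dots> \<le> X \<bullet> X" using c by simp
  finally have "(norm (X - (c * (p \<bullet> X)) *\<^sub>R p))\<^sup>2 \<le> X \<bullet> X" .
  then have "weight p / 2 * (norm (X - (c * (p \<bullet> X)) *\<^sub>R p))\<^sup>2 \<le> weight p / 2 * (X \<bullet> X)"
    using weight_pos[of p] by (intro mult_left_mono) auto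
  moreover have "(norm (short_map_deriv p X))\<^sup>2 = weight p / 2 * (norm (X - (c * (p \<bullet> X)) *\<^sub>R p))\<^sup>2"
    using weight_pos[of p] by (simp add: short_map_deriv_def c_def power_mult_distrib)
  ultimately show "(norm (short_map_deriv p X))\<^sup>2 \<le> root_metric p X X"
    using root_metric_lower[of p X] by simp
qed

lemma dist_short_map_le_length:
  assumes "valid_path \<gamma>" "has_length root_metric \<gamma> L"
  shows "norm (short_map (pathfinish \<gamma>) - short_map (pathstart \<gamma>)) \<le> L"
proof -
  obtain S where S: "finite S" "continuous_on {0..1} \<gamma>" "\<gamma> C1_differentiable_on ({0..1} - S)"
    using assms(1) by (auto simp: valid_path_def piecewise_C1_differentiable_on_def)
  let ?D = "\<lambda>t. vector_derivative \<gamma> (at t)"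
  have "((\<lambda>t. short_map_deriv (\<gamma> t) (?D t)) has_integral ((short_map \<circ> \<gamma>) 1
      - (short_map \<circ> \<gamma>) 0)) {0..1}"
  \<comment> \<open>This version needs continuity and a derivative off a finite set only, so
    unbounded speed near a break point is harmless.\<close>
  proof (rule fundamental_theorem_of_calculus_interior_strong[OF S(1)])
    fix t assume "t \<in> {0<..<1} - S"
    then have "(\<gamma> has_vector_derivative ?D t) (at t)"
      using S(3) unfolding C1_differentiable_on_eq by (simp add: vector_derivative_works)
    then show "(short_map \<circ> \<gamma> has_vector_derivative short_map_deriv (\<gamma> t) (?D t)) (at t)"
      by (rule vector_derivative_diff_chain_within)
        (rule has_derivative_at_withinI[OF has_derivative_short_map])
  next
    have "continuous_on UNIV (short_map :: complex^'a \<Rightarrow> _)"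
      by (auto intro!: continuous_at_imp_continuous_on
            has_derivative_continuous[OF has_derivative_short_map])
    then show "continuous_on {0..1} (short_map \<circ> \<gamma>)"
      using S(2) by (intro continuous_on_compose) (auto intro: continuous_on_subset)
  qed simp
  note I = this
  have "norm (integral {0..1} (\<lambda>t. short_map_deriv (\<gamma> t) (?D t)))
      \<le> integral {0..1} (\<lambda>t. sqrt (root_metric (\<gamma> t) (?D t) (?D t)))"
    using assms(2) I
      by (intro integral_norm_bound_integral norm_short_map_deriv) (auto simp: has_length_def)
  then show ?thesis
    using assms(2) I by (simp add: has_length_def integral_unique pathfinish_def pathstart_def)
qed

lemma linepath_length:
  obtains L where "has_length root_metric (linepath p q) L" "L \<le> norm (q - p)"
proof -
  let ?f = "\<lambda>t. sqrt (root_metric (linepath p q t) (q - p) (q - p))"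
  have "continuous_on UNIV (\<lambda>r. root_metric r (q - p) (q - p))"
    by (auto intro!: continuous_at_imp_continuous_on
          has_derivative_continuous[OF has_derivative_root_metric])
  then have "continuous_on {0..1} ?f"
    by (intro continuous_on_real_sqrt continuous_on_compose2[OF _ continuous_on_linepath]) auto
  then have f: "?f integrable_on {0..1}" by (rule integrable_continuous_interval)
  have "integral {0..1} ?f \<le> integral {0..1} (\<lambda>_::real. norm (q - p))"
    using f by (intro integral_le) (auto simp: norm_eq_sqrt_inner root_metric_upper)
  moreover have "has_length root_metric (linepath p q) (integral {0..1} ?f)"
    using f by (simp add: has_length_def vector_derivative_linepath_at has_integral_integral)
  ultimately show ?thesis using that by simp
qed

text \<open>The segment makes the set of lengths nonempty and the short map bounds it below, so the
  infimum is a genuine one.\<close>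

lemma riem_dist_root_metric_le: "riem_dist root_metric p q \<le> norm (q - p)"
  and dist_short_map_le_riem_dist: "norm (short_map q - short_map p) \<le> riem_dist root_metric p q"
proof -
  let ?A = "{L. \<exists>\<gamma>. valid_path \<gamma> \<and> pathstart \<gamma> = p \<and> pathfinish \<gamma> = q \<and> has_length root_metric \<gamma> L}"
  have lower: "norm (short_map q - short_map p) \<le> L" if "L \<in> ?A" for L
    using that dist_short_map_le_length by fastforce
  obtain L where "has_length root_metric (linepath p q) L" and L: "L \<le> norm (q - p)"
    by (rule linepath_length)
  then have LA: "L \<in> ?A" using valid_path_linepath[of p q] by fastforce
  have "bdd_below ?A" using lower by (rule bdd_belowI)
  from cInf_lower2[OF LA L this] show "riem_dist root_metric p q \<le> norm (q - p)"
    unfolding riem_dist_def .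
  have "?A \<noteq> {}" using LA by blast
  from cInf_greatest[OF this lower] show
      "norm (short_map q - short_map p) \<le> riem_dist root_metric p q"
    unfolding riem_dist_def .
qed

text \<open>With \<open>q = s\<^sup>2 / (1 + s)\<close>, the square of \<open>2 |short_map p|\<^sup>2\<close>, the value of \<open>s\<close> is recovered
  as the positive root of \<open>s\<^sup>2 - q s - q\<close>.\<close>

definition short_map_inv :: "complex^'m \<Rightarrow> complex^'m" where
  "short_map_inv y = (let q = (2 * (y \<bullet> y))\<^sup>2; s
      = (q + sqrt (q\<^sup>2 + 4 * q)) / 2 in (sqrt 2 * sqrt (sqrt (1 + s))) *\<^sub>R y)"

lemma short_map_inv_short_map: "short_map_inv (short_map p) = p"
proof -
  define s where "s = p \<bullet> p"
  define q where "q = (2 * (short_map p \<bullet> short_map p))\<^sup>2"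
  have s: "s \<ge> 0" by (simp add: s_def)
  have "2 * (short_map p \<bullet> short_map p) = weight p * s"
    using weight_pos[of p] by (simp add: short_map_def s_def mult.assoc[symmetric])
  then have q: "q = s\<^sup>2 / (1 + s)"
    by (simp add: q_def power_mult_distrib weight_square s_def)
  have "q\<^sup>2 + 4 * q = (s * (s + 2) / (1 + s))\<^sup>2"
    using s unfolding q by (simp add: divide_simps power2_eq_square) (simp add: algebra_simps)
  then have "sqrt (q\<^sup>2 + 4 * q) = s * (s + 2) / (1 + s)"
    using s by (simp only: real_sqrt_abs) simp
  then have "(q + sqrt (q\<^sup>2 + 4 * q)) / 2 = s"
    using s unfolding q by (simp add: divide_simps power2_eq_square) (simp add: algebra_simps)
  then have
      "short_map_inv (short_map p) = (sqrt 2 * sqrt (sqrt (1 + s)) * sqrt (weight p / 2)) *\<^sub>R p"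
    by (simp add: short_map_inv_def Let_def q_def short_map_def)
  also have "sqrt 2 * sqrt (sqrt (1 + s)) * sqrt (weight p / 2) = 1"
    using s by (simp add: weight_def s_def[symmetric] real_sqrt_divide flip: real_sqrt_mult)
  finally show ?thesis by simp
qed

text \<open>The closed formula with square roots covers y = 0 without a case distinction.\<close>

lemma continuous_short_map_inv: "isCont short_map_inv y"
  unfolding short_map_inv_def Let_def by (intro continuous_intros) auto

text \<open>The lower distance bound makes the images under \<open>short_map\<close> Cauchy, the
  continuous left inverse carries their limit back, and the upper bound turns Euclidean convergence
  into convergence for \<open>riem_dist\<close>.\<close>

lemma complete_root_metric: "complete_metric (root_metric :: (complex^'m) metric_tensor)"
  unfolding complete_metric_def
proof (intro allI impI)
  fix x :: "nat \<Rightarrow> complex^'m"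
  assume x: "\<forall>e>0. \<exists>N. \<forall>m\<ge>N. \<forall>n\<ge>N. riem_dist root_metric (x m) (x n) < e"
  have "Cauchy (\<lambda>n. short_map (x n))"
    unfolding Cauchy_def
  proof (intro allI impI)
    fix e :: real assume "e > 0"
    with x obtain N where N: "\<forall>m\<ge>N. \<forall>n\<ge>N. riem_dist root_metric (x m) (x n) < e" by blast
    have "dist (short_map (x m)) (short_map (x n)) < e" if "m \<ge> N" "n \<ge> N" for m n
      using le_less_trans[OF dist_short_map_le_riem_dist N[rule_format, OF that]]
      by (simp add: dist_norm norm_minus_commute)
    then show "\<exists>N. \<forall>m\<ge>N. \<forall>n\<ge>N. dist (short_map (x m)) (short_map (x n)) < e" by blast
  qed
  then obtain y where "(\<lambda>n. short_map (x n)) \<longlonglongrightarrow> y"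
    by (auto simp: Cauchy_convergent_iff convergent_def)
  from isCont_tendsto_compose[OF continuous_short_map_inv this] have lim: "x \<longlonglongrightarrow> short_map_inv y"
    by (simp add: short_map_inv_short_map)
  have 0: "(\<lambda>n. norm (short_map_inv y - x n)) \<longlonglongrightarrow> 0"
    using lim[THEN tendsto_dist_iff[THEN iffD1]] by (simp add: dist_norm norm_minus_commute)
  have "0 \<le> riem_dist root_metric p q" for p q :: "complex^'m"
    by (rule order_trans[OF norm_ge_zero dist_short_map_le_riem_dist])
  then have "(\<lambda>n. riem_dist root_metric (x n) (short_map_inv y)) \<longlonglongrightarrow> 0"
    by (intro tendsto_sandwich[OF _ _ tendsto_const 0] always_eventually allI
          riem_dist_root_metric_le)
  then show "\<exists>l. (\<lambda>n. riem_dist root_metric (x n) l) \<longlonglongrightarrow> 0" by blast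
qed

theorem theorem7p1:
  assumes "CARD('m::finite) \<ge> 2"
  shows "\<exists>g :: (complex^'m) metric_tensor.
           kaehler_metric g \<and> unitary_invariant g \<and> complete_metric g \<and>
           positive_ricci g \<and> positive_orthogonal_bisect_curv g \<and>
           hol_sect_curv_negative_somewhere g"
  using kaehler_root_metric unitary_invariant_root_metric complete_root_metric
    positive_ricci_root_metric[OF assms]
    positive_orthogonal_bisect_root_metric hol_sect_curv_negative_root_metric
  by blast

end
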